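(* Let $V$ be a $C_2$-cofinite vertex operator superalgebra, and let $g,h$ be commuting automorphisms of finite orders $T,T_1$. Then every formal $(g,h)$ 1-point function $S$ converges. More precisely, for each $v$, $S(v,q)$ with $q=e^{2\pi i\tau}$ converges to a holomorphic function on $\mathfrak h$, and the assignment $S(v,\tau):=S(v,e^{2\pi i\tau})$ defines an element of $\mathcal C(g,h)$.
   Context: A vertex operator superalgebra (VOSA) $V=V_{\bar0}\oplus V_{\bar1}$ has the following structure. - Vertex operators $Y(v,z)=\sum v(n)z^{-n-1}$, vacuum $\mathbf1$, and conformal vector $\omega$ (central charge $c$). - The super Jacobi identity holds with sign $(-1)^{\tilde u\tilde v}$. - $V=\bigoplus_{n\in\frac12\mathbb Z}V_n$ by $L(0)$-weight, with $V_{\bar0}$ integral and $V_{\bar1}$ half-integral weights. $\sigma$ is the parity automorphism, and $\epsilon_v=(-1)^{\tilde v}$. $C_2$-cofinite means $\mathrm{span}\{u(-2)v\}$ has finite codimension. $Y[v,z]=Y(v,e^z-1)e^{z\,\mathrm{wt}v}=\sum v[n]z^{-n-1}$; $\tilde\omega=\omega-\frac c{24}\mathbf1$; $Y[\tilde\omega,z]=\sum L[n]z^{-n-2}$; $V_{[k]}$ is the $L[0]$-eigenspace of eigenvalue $k$. $E_{2k}(\tau)=-\frac{B_{2k}(0)}{(2k)!}+\frac2{(2k-1)!}\sum_{n\ge1}\sigma_{2k-1}(n)q^n$, with $B_r$ the Bernoulli polynomials. For $\mu=e^{2\pi ij/M}$ ($0\le j<M$) and a root of unity $\lambda$ with $(\mu,\lambda)\ne(1,1)$: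 $Q_0=-1$, and for $k\ge1$ $Q_k(\mu,\lambda,\tau)=\frac1{(k-1)!}\sum_{n\ge0}\frac{\lambda(n+j/M)^{k-1}q^{n+j/M}}{1-\lambda q^{n+j/M}}+\frac{(-1)^k}{(k-1)!}\sum_{n\ge1}\frac{\lambda^{-1}(n-j/M)^{k-1}q^{n-j/M}}{1-\lambda^{-1}q^{n-j/M}}-\frac{B_k(j/M)}{k!}$. With $N=\mathrm{lcm}(T,T_1)$: $\Gamma(T,T_1)=\{\begin{pmatrix}a&b\\c&d\end{pmatrix}:a\equiv d\equiv1\ (N),b\equiv0\ (T),c\equiv0\ (T_1)\}$; $M(T,T_1)$ is the ring of holomorphic modular forms on $\Gamma(T,T_1)$; $V(T,T_1)=M(T,T_1)\otimes V$. $O(g,h)$ is the $M(T,T_1)$-submodule spanned, for $\mathbb Z_2$-homogeneous $v$ with $gv=\mu^{-1}v$, $hv=\lambda^{-1}v$ and any $w$, by: - $v[0]w$ and $v[-2]w+\sum_{k\ge2}(2k-1)E_{2k}\otimes v[2k-2]w$ when $(\mu,\lambda)=(1,1)$; - $v$ when $(\epsilon_v,\mu,\lambda)\ne(1,1,1)$; - $\sum_{k\ge0}Q_k(\mu,\lambda,\tau)\otimes v[k-1]w$ when $(\mu,\lambda)\ne(1,1)$. $\mathcal C(g,h)$ is the space of $S:V(T,T_1)\times\mathfrak h\to\mathbb C$ that are holomorphic in $\tau$, $M(T,T_1)$-linear in $v$, vanish on $O(g,h)$, and satisfy $S(L[-2]v,\tau)=\partial S(v,\tau)+\sum_{l\ge2}E_{2l}(\tau)S(L[2l-2]v,\tau)$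 for $v$ fixed by $\sigma,g,h$, where $\partial S(v,\tau)=\frac1{2\pi i}\frac d{d\tau}S(v,\tau)+kE_2(\tau)S(v,\tau)$ for $v\in V_{[k]}$. A formal $(g,h)$ 1-point function is a map $S$ from $V(T,T_1)$ to the space of formal series $q^\lambda\sum_{n\ge0}a_nq^{n/T}$ ($\lambda\in\mathbb C$) satisfying the same conditions (linearity, vanishing on $O(g,h)$, and the $L[-2]$ identity). In these conditions modular forms and $E_{2k}$ are identified with their $q$-expansions, and $\frac1{2\pi i}\frac d{d\tau}$ is replaced by $q\frac d{dq}$. *)

theory Defs
  imports "HOL-Analysis.Analysis" "HOL-Computational_Algebra.Formal_Laurent_Series"
begin

definition fsum :: "('i \<Rightarrow> 'a::comm_monoid_add) \<Rightarrow> 'a" where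
  "fsum f = (\<Sum>k\<in>{k. f k \<noteq> 0}. f k)"

text \<open>Data: scalar multiplication, weight spaces V_r (r real, nonzero only for r in 1/2 Z),
  the modes u(n)w = Y u n w, the vacuum, the conformal vector and the central charge.\<close>

record 'v vosa =
  scl :: "complex \<Rightarrow> 'v \<Rightarrow> 'v"
  wsp :: "real \<Rightarrow> 'v set"
  Y   :: "'v \<Rightarrow> int \<Rightarrow> 'v \<Rightarrow> 'v"
  vac :: 'v
  om  :: 'v
  cc  :: complex

definition is_wdecomp :: "('v::ab_group_add) vosa \<Rightarrow> 'v \<Rightarrow> (real \<Rightarrow> 'v) \<Rightarrow> bool" where
  "is_wdecomp V v cmp \<longleftrightarrow> finite {r. cmp r \<noteq> 0} \<and> (\<forall>r. cmp r \<in> wsp V r)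
      \<and> v = (\<Sum>r\<in>{r. cmp r \<noteq> 0}. cmp r)"

definition wcomp :: "('v::ab_group_add) vosa \<Rightarrow> 'v \<Rightarrow> real \<Rightarrow> 'v" where
  "wcomp V v = (THE cmp. is_wdecomp V v cmp)"

definition par_hom :: "('v::ab_group_add) vosa \<Rightarrow> bool \<Rightarrow> 'v \<Rightarrow> bool" where
  "par_hom V p v \<longleftrightarrow> (\<forall>r. wcomp V v r \<noteq> 0 \<longrightarrow> (if p then r - 1/2 \<in> \<int> else r \<in> \<int>))"

definition par_aut :: "('v::ab_group_add) vosa \<Rightarrow> 'v \<Rightarrow> 'v" where
  "par_aut V v = (\<Sum>r\<in>{r. wcomp V v r \<noteq> 0}. scl V (if r \<in> \<int> then 1 else -1) (wcomp V v r))"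

definition sgn_par :: "bool \<Rightarrow> complex" where
  "sgn_par p = (if p then -1 else 1)"

definition is_vosa :: "('v::ab_group_add) vosa \<Rightarrow> bool" where
  "is_vosa V \<longleftrightarrow>
     vector_space (scl V)
   \<comment> \<open>grading: finite-dimensional weight spaces, weights in 1/2 Z, bounded below, direct sum\<close>
   \<and> (\<forall>r. module.subspace (scl V) (wsp V r))
   \<and> (\<forall>r. \<exists>B. finite B \<and> B \<subseteq> wsp V r \<and> module.span (scl V) B = wsp V r)
   \<and> (\<forall>r. 2 * r \<notin> \<int> \<longrightarrow> wsp V r = {0})
   \<and> (\<exists>r0. \<forall>r < r0. wsp V r = {0})
   \<and> (\<forall>v. \<exists>!cmp. is_wdecomp V v cmp)
   \<comment> \<open>bilinearity of the modes\<close>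
   \<and> (\<forall>u u' n w. Y V (u + u') n w = Y V u n w + Y V u' n w)
   \<and> (\<forall>a u n w. Y V (scl V a u) n w = scl V a (Y V u n w))
   \<and> (\<forall>u n w w'. Y V u n (w + w') = Y V u n w + Y V u n w')
   \<and> (\<forall>a u n w. Y V u n (scl V a w) = scl V a (Y V u n w))
   \<comment> \<open>truncation\<close>
   \<and> (\<forall>u w. \<exists>N. \<forall>n\<ge>N. Y V u n w = 0)
   \<comment> \<open>vacuum\<close>
   \<and> (\<forall>n w. Y V (vac V) n w = (if n = -1 then w else 0))
   \<and> (\<forall>u n. n \<ge> 0 \<longrightarrow> Y V u n (vac V) = 0)
   \<and> (\<forall>u. Y V u (-1) (vac V) = u)
   \<comment> \<open>conformal vector: L(n) = omega(n+1)\<close>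
   \<and> vac V \<in> wsp V 0 \<and> om V \<in> wsp V 2
   \<and> (\<forall>r v. v \<in> wsp V r \<longrightarrow> Y V (om V) 1 v = scl V (complex_of_real r) v)
   \<and> (\<forall>m n v. Y V (om V) (m+1) (Y V (om V) (n+1) v) - Y V (om V) (n+1) (Y V (om V) (m+1) v)
          = scl V (of_int (m - n)) (Y V (om V) (m+n+1) v)
            + scl V (if m + n = 0 then (of_int (m^3 - m) / 12) * cc V else 0) v)
   \<and> (\<forall>u n w. Y V (Y V (om V) 0 u) n w = scl V (- of_int n) (Y V u (n - 1) w))
   \<comment> \<open>super Jacobi identity, in Borcherds form, for parity-homogeneous u, v\<close>
   \<and> (\<forall>p p' u v w m n l. par_hom V p u \<longrightarrow> par_hom V p' v \<longrightarrow>
        fsum (\<lambda>i::nat. scl V ((of_int m) gchoose i) (Y V (Y V u (l + int i) v) (m + n - int i) w))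
      = fsum (\<lambda>i::nat. scl V ((-1)^i * ((of_int l) gchoose i))
            (Y V u (m + l - int i) (Y V v (n + int i) w)
             - scl V ((-1) powi l * sgn_par (p \<and> p')) (Y V v (n + l - int i) (Y V u (m + int i) w)))))"

definition C2_cofinite :: "('v::ab_group_add) vosa \<Rightarrow> bool" where
  "C2_cofinite V \<longleftrightarrow> (\<exists>B. finite B \<and>
      module.span (scl V) (B \<union> {Y V u (-2) v | u v. True}) = UNIV)"

definition vosa_aut :: "('v::ab_group_add) vosa \<Rightarrow> ('v \<Rightarrow> 'v) \<Rightarrow> bool" where
  "vosa_aut V g \<longleftrightarrow> bij g \<and> (\<forall>u v. g (u + v) = g u + g v) \<and> (\<forall>a v. g (scl V a v) = scl V a (g v))
     \<and> (\<forall>u n v. g (Y V u n v) = Y V (g u) n (g v)) \<and> g (vac V) = vac V \<and> g (om V) = om V"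

definition has_order :: "('v \<Rightarrow> 'v) \<Rightarrow> nat \<Rightarrow> bool" where
  "has_order g T \<longleftrightarrow> T > 0 \<and> (g ^^ T) = id \<and> (\<forall>k. 0 < k \<and> k < T \<longrightarrow> (g ^^ k) \<noteq> id)"

definition bcoef :: "int \<Rightarrow> int \<Rightarrow> complex \<Rightarrow> complex" where
  "bcoef m n a = fls_nth ((fps_to_fls (fps_exp 1) - 1) powi (-m-1) * fps_to_fls (fps_exp a)) (-n-1)"

text \<open>v[n]w for homogeneous v is sum_m bcoef(m,n,wt v) v(m)w (only m >= n contribute);
  extended linearly to all v.\<close>
definition brk :: "('v::ab_group_add) vosa \<Rightarrow> 'v \<Rightarrow> int \<Rightarrow> 'v \<Rightarrow> 'v" where
  "brk V v n w = (\<Sum>r\<in>{r. wcomp V v r \<noteq> 0}.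
      \<Sum>m\<in>{m. n \<le> m \<and> Y V (wcomp V v r) m w \<noteq> 0}.
         scl V (bcoef m n (complex_of_real r)) (Y V (wcomp V v r) m w))"

text \<open>L[n] from Y[omega~, z] = sum L[n] z^(-n-2), omega~ = omega - c/24 vac.\<close>
definition Lbr :: "('v::ab_group_add) vosa \<Rightarrow> int \<Rightarrow> 'v \<Rightarrow> 'v" where
  "Lbr V n v = brk V (om V - scl V (cc V / 24) (vac V)) (n + 1) v"

definition bernpoly :: "nat \<Rightarrow> complex \<Rightarrow> complex" where
  "bernpoly n x = fact n *
     fls_nth (fls_X * fps_to_fls (fps_exp x) / (fps_to_fls (fps_exp 1) - 1)) (int n)"

definition divsum :: "nat \<Rightarrow> nat \<Rightarrow> complex" where
  "divsum k n = (\<Sum>d\<in>{d. d dvd n}. of_nat d ^ k)"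

definition qpow :: "complex \<Rightarrow> complex \<Rightarrow> complex" where
  "qpow e \<tau> = exp (2 * pi * \<i> * e * \<tau>)"

text \<open>E_{2k}(tau) (argument k means weight 2k).\<close>
definition eis :: "nat \<Rightarrow> complex \<Rightarrow> complex" where
  "eis k \<tau> = - bernpoly (2*k) 0 / fact (2*k)
     + 2 / fact (2*k - 1) * (\<Sum>n. divsum (2*k - 1) (Suc n) * qpow (of_nat (Suc n)) \<tau>)"

text \<open>Q_k(mu, lambda, tau) with mu = e^(2 pi i r), r = j/M in [0,1).\<close>
definition Qfun :: "nat \<Rightarrow> real \<Rightarrow> complex \<Rightarrow> complex \<Rightarrow> complex" where
  "Qfun k r lam \<tau> = (if k = 0 then -1 else
      1 / fact (k - 1) * (\<Sum>n. lam * (of_real (real n + r)) ^ (k-1) * qpow (of_real (real n + r)) \<tau>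
                                / (1 - lam * qpow (of_real (real n + r)) \<tau>))
    + (-1)^k / fact (k - 1) * (\<Sum>n. inverse lam * (of_real (real (Suc n) - r)) ^ (k-1)
                                * qpow (of_real (real (Suc n) - r)) \<tau>
                                / (1 - inverse lam * qpow (of_real (real (Suc n) - r)) \<tau>))
    - bernpoly k (of_real r) / fact k)"

section \<open>Generalised formal q-series: coefficient of q^e for each complex exponent e\<close>

type_synonym gser = "complex \<Rightarrow> complex"

text \<open>The space spanned by the series q^lambda sum_n a_n q^(n/T).\<close>
definition fser_ok :: "nat \<Rightarrow> gser \<Rightarrow> bool" where
  "fser_ok T f \<longleftrightarrow> (\<exists>\<Lambda>. finite \<Lambda> \<and>
      (\<forall>e. f e \<noteq> 0 \<longrightarrow> (\<exists>lm\<in>\<Lambda>. \<exists>n::nat. e = lm + of_nat n / of_nat T)))"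

definition gmul :: "gser \<Rightarrow> gser \<Rightarrow> gser" where
  "gmul f g e = (\<Sum>(a,b)\<in>{(a,b). a + b = e \<and> f a \<noteq> 0 \<and> g b \<noteq> 0}. f a * g b)"

definition gder :: "gser \<Rightarrow> gser" where
  "gder f e = e * f e"

definition eis_q :: "nat \<Rightarrow> gser" where
  "eis_q k e = (if e = 0 then - bernpoly (2*k) 0 / fact (2*k)
     else if (\<exists>n::nat. n > 0 \<and> e = of_nat n)
       then 2 / fact (2*k - 1) * divsum (2*k - 1) (THE n. e = of_nat n) else 0)"

text \<open>q-expansion of Q_k: expand lam x^(k-1) q^x/(1 - lam q^x) = sum_{m>=1} lam^m x^(k-1) q^(m x)
  for x > 0 (the term x = 0, present when r = 0, is the constant lam 0^(k-1)/(1-lam)).\<close>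
definition Q_q :: "nat \<Rightarrow> real \<Rightarrow> complex \<Rightarrow> gser" where
  "Q_q k r lam e = (if k = 0 then (if e = 0 then -1 else 0) else
      1 / fact (k - 1) *
        ((\<Sum>(n,m)\<in>{(n,m). (n::nat) \<ge> 0 \<and> (m::nat) \<ge> 1 \<and> real n + r > 0
                         \<and> e = of_real (real m * (real n + r))}.
            lam ^ m * (of_real (real n + r)) ^ (k-1))
         + (if r = 0 \<and> e = 0 then lam * 0 ^ (k-1) / (1 - lam) else 0))
    + (-1)^k / fact (k - 1) *
        (\<Sum>(n,m)\<in>{(n,m). (n::nat) \<ge> 1 \<and> (m::nat) \<ge> 1 \<and> e = of_real (real m * (real n - r))}.
            (inverse lam) ^ m * (of_real (real n - r)) ^ (k-1))
    - (if e = 0 then bernpoly k (of_real r) / fact k else 0))"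

definition uhp :: "complex set" where
  "uhp = {\<tau>. Im \<tau> > 0}"

definition conf_block :: "('v::ab_group_add) vosa \<Rightarrow> ('v \<Rightarrow> 'v) \<Rightarrow> ('v \<Rightarrow> 'v) \<Rightarrow> nat \<Rightarrow> nat
     \<Rightarrow> ('v \<Rightarrow> complex \<Rightarrow> complex) \<Rightarrow> bool" where
  "conf_block V g h T T1 S \<longleftrightarrow>
     (\<forall>v. S v holomorphic_on uhp)
   \<and> (\<forall>u v \<tau>. \<tau> \<in> uhp \<longrightarrow> S (u + v) \<tau> = S u \<tau> + S v \<tau>)
   \<and> (\<forall>a v \<tau>. \<tau> \<in> uhp \<longrightarrow> S (scl V a v) \<tau> = a * S v \<tau>)
   \<comment> \<open>vanishing on O(g,h), case (mu,lambda) = (1,1)\<close>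
   \<and> (\<forall>p v w \<tau>. \<tau> \<in> uhp \<longrightarrow> par_hom V p v \<longrightarrow> g v = v \<longrightarrow> h v = v \<longrightarrow>
        S (brk V v 0 w) \<tau> = 0
      \<and> S (brk V v (-2) w) \<tau>
        + fsum (\<lambda>k::nat. if 2 \<le> k then of_nat (2*k - 1) * eis k \<tau> * S (brk V v (2 * int k - 2) w) \<tau> else 0)
        = 0)
   \<comment> \<open>general eigenvalues mu = e^(2 pi i j/T), lambda\<close>
   \<and> (\<forall>p v w \<tau> j lam. \<tau> \<in> uhp \<longrightarrow> j < T \<longrightarrow> par_hom V p v
        \<longrightarrow> g v = scl V (inverse (exp (2 * pi * \<i> * of_nat j / of_nat T))) v
        \<longrightarrow> h v = scl V (inverse lam) v \<longrightarrow>
          ((p \<or> j \<noteq> 0 \<or> lam \<noteq> 1) \<longrightarrow> S v \<tau> = 0)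
        \<and> ((j \<noteq> 0 \<or> lam \<noteq> 1) \<longrightarrow>
             fsum (\<lambda>k::nat. Qfun k (real j / real T) lam \<tau> * S (brk V v (int k - 1) w) \<tau>) = 0))
   \<comment> \<open>the L[-2] identity\<close>
   \<and> (\<forall>v k \<tau>. \<tau> \<in> uhp \<longrightarrow> par_aut V v = v \<longrightarrow> g v = v \<longrightarrow> h v = v
        \<longrightarrow> Lbr V 0 v = scl V k v \<longrightarrow>
        S (Lbr V (-2) v) \<tau> = deriv (S v) \<tau> / (2 * pi * \<i>) + k * eis 1 \<tau> * S v \<tau>
          + fsum (\<lambda>l::nat. if 2 \<le> l then eis l \<tau> * S (Lbr V (2 * int l - 2) v) \<tau> else 0))"

definition formal_1pt :: "('v::ab_group_add) vosa \<Rightarrow> ('v \<Rightarrow> 'v) \<Rightarrow> ('v \<Rightarrow> 'v) \<Rightarrow> nat \<Rightarrow> nat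
     \<Rightarrow> ('v \<Rightarrow> gser) \<Rightarrow> bool" where
  "formal_1pt V g h T T1 S \<longleftrightarrow>
     (\<forall>v. fser_ok T (S v))
   \<and> (\<forall>u v e. S (u + v) e = S u e + S v e)
   \<and> (\<forall>a v e. S (scl V a v) e = a * S v e)
   \<and> (\<forall>p v w e. par_hom V p v \<longrightarrow> g v = v \<longrightarrow> h v = v \<longrightarrow>
        S (brk V v 0 w) e = 0
      \<and> S (brk V v (-2) w) e
        + fsum (\<lambda>k::nat. if 2 \<le> k then of_nat (2*k - 1) * gmul (eis_q k) (S (brk V v (2 * int k - 2) w)) e else 0)
        = 0)
   \<and> (\<forall>p v w e j lam. j < T \<longrightarrow> par_hom V p v
        \<longrightarrow> g v = scl V (inverse (exp (2 * pi * \<i> * of_nat j / of_nat T))) v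
        \<longrightarrow> h v = scl V (inverse lam) v \<longrightarrow>
          ((p \<or> j \<noteq> 0 \<or> lam \<noteq> 1) \<longrightarrow> S v e = 0)
        \<and> ((j \<noteq> 0 \<or> lam \<noteq> 1) \<longrightarrow>
             fsum (\<lambda>k::nat. gmul (Q_q k (real j / real T) lam) (S (brk V v (int k - 1) w)) e) = 0))
   \<and> (\<forall>v k e. par_aut V v = v \<longrightarrow> g v = v \<longrightarrow> h v = v
        \<longrightarrow> Lbr V 0 v = scl V k v \<longrightarrow>
        S (Lbr V (-2) v) e = gder (S v) e + k * gmul (eis_q 1) (S v) e
          + fsum (\<lambda>l::nat. if 2 \<le> l then gmul (eis_q l) (S (Lbr V (2 * int l - 2) v)) e else 0))"

definition geval :: "gser \<Rightarrow> complex \<Rightarrow> complex" where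
  "geval f \<tau> = (\<Sum>\<^sub>\<infinity>e. f e * qpow e \<tau>)"

end

theory Submission
  imports Defs "HOL-Complex_Analysis.Complex_Analysis"
begin

text \<open>
  No ODE theory and no modular forms are needed. Fix \<open>\<tau>\<close> in the upper half plane and measure a
  series by its truncated norms \<open>\<Sum>\<bar>f\<^sub>e q^e\<bar>\<close>, the sum running over the exponents with \<open>Re e \<le> x\<close>.
  Multiplication by an absolutely convergent series with exponents \<open>\<ge> 0\<close> is bounded for these norms,
  uniformly in \<open>x\<close>. As \<open>u[-2]w = u(-2)w + (lower weight)\<close>, \<open>C\<^sub>2\<close>-cofiniteness and the relations \<open>O(g,h)\<close>
  bound all \<open>S(v)\<close>, by induction on the weight, in terms of finitely many \<open>S(w)\<close> of small
  weight. The \<open>L[-2]\<close> identity then bounds \<open>q d/dq\<close> on these series, and an Euler operator that is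
  bounded uniformly in \<open>x\<close> forces the truncated norms themselves to be bounded: this is absolute
  convergence at \<open>\<tau>\<close>. The identities defining \<open>C(g,h)\<close> follow by evaluating the formal ones termwise.
\<close>

section \<open>Evaluation of formal q-series\<close>

text \<open>The bound is circular at first sight: all series are compared with a function
  \<open>M\<close> of the cutoff that is itself the sum of the truncated norms of the finitely many
  \<open>S w\<close>, of unknown growth. Domination is therefore set up relative to an arbitrary
  \<open>M\<close>, and the weight bound for the \<open>w\<close> is chosen before \<tau> and
  \<open>M\<close>. The Euler operator breaks the circle, since large exponents make it large. Two
  steps do not come straight from the relations. For (mu, lambda) other than (1,1),
  \<open>O(g,h)\<close> controls u[-1]w, not u[-2]w; the remedy is to insert L(-1)u in place of u,
  which has the same eigenvalues and satisfies (L(-1)u)(-1) = u(-2). And the L[-2] identity speaks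
  of eigenvectors of L[0], while C2-cofiniteness is exploited along the L(0)-grading; the two
  operators differ by one that lowers the weight, so L[0] can be diagonalised on invariant vectors,
  and S kills the remaining joint eigenvectors. Convergence is obtained at each \<tau> separately;
  local uniformity then follows from convergence at a single lower point.\<close>

lemma qpow_add: "qpow (a + b) \<tau> = qpow a \<tau> * qpow b \<tau>"
  by (simp add: qpow_def algebra_simps flip: exp_add)

lemma qpow_0 [simp]: "qpow 0 \<tau> = 1"
  by (simp add: qpow_def)

lemma norm_qpow: "cmod (qpow e \<tau>) = exp (- (2 * pi * (Re e * Im \<tau> + Im e * Re \<tau>)))"
  by (simp add: qpow_def algebra_simps)

lemma norm_qpow_real: "cmod (qpow (of_real x) \<tau>) = exp (- (2 * pi * x * Im \<tau>))"
  by (simp add: norm_qpow)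

lemma qpow_of_nat_mult: "qpow (of_nat m * e) \<tau> = qpow e \<tau> ^ m"
  by (induction m) (simp_all add: algebra_simps qpow_add)

lemma has_field_derivative_qpow:
  "(qpow e has_field_derivative 2 * pi * \<i> * e * qpow e \<tau>) (at \<tau> within A)"
  unfolding qpow_def[abs_def] by (rule derivative_eq_intros refl | simp)+

lemma power_le_exp:
  fixes x d :: real
  assumes "x \<ge> 0" "d > 0"
  shows "x ^ k \<le> fact k / d ^ k * exp (d * x)"
proof -
  have "(d * x) ^ k / fact k \<le> (\<Sum>n. (d * x) ^ n /\<^sub>R fact n)"
    using assms sum_le_suminf[OF summable_exp_generic[of "d * x"], of "{k}"]
    by (simp add: divide_inverse mult.commute)
  also have "\<dots> = exp (d * x)" by (simp add: exp_def)
  finally show ?thesis using assms by (simp add: field_simps power_mult_distrib)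
qed

text \<open>Half of the decay of \<open>qpow\<close> pays for the power of x; the other half is left
  over as a summable majorant.\<close>

lemma power_mult_norm_qpow_le:
  assumes "x \<ge> 0" "\<tau> \<in> uhp"
  shows "x ^ k * cmod (qpow (of_real x) \<tau>) \<le> fact k / (pi * Im \<tau>) ^ k * exp (- (pi * x * Im \<tau>))"
proof -
  have pos: "pi * Im \<tau> > 0" using assms by (simp add: uhp_def)
  have "x ^ k * cmod (qpow (of_real x) \<tau>)
      \<le> (fact k / (pi * Im \<tau>) ^ k * exp (pi * Im \<tau> * x)) * cmod (qpow (of_real x) \<tau>)"
    using power_le_exp[OF assms(1) pos] by (intro mult_right_mono) auto
  also have "\<dots> = fact k / (pi * Im \<tau>) ^ k * exp (- (pi * x * Im \<tau>))"
    by (simp add: norm_qpow_real mult.assoc algebra_simps flip: exp_add)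
  finally show ?thesis .
qed

lemma summable_exp_neg:
  assumes "c > (0::real)"
  shows "summable (\<lambda>n::nat. exp (- (c * real n)))"
proof -
  have "(\<lambda>n::nat. exp (- (c * real n))) = (\<lambda>n. exp (- c) ^ n)"
    by (simp add: exp_of_nat_mult[symmetric] mult.commute fun_eq_iff)
  thus ?thesis using assms by (simp add: summable_geometric)
qed

text \<open>Exponents are complex and come in no preferred order, so convergence means unconditional
  summability over all of them. For complex terms this is absolute summability, which allows free
  regrouping.\<close>

definition gconv :: "gser \<Rightarrow> complex \<Rightarrow> bool" where
  "gconv f \<tau> \<longleftrightarrow> (\<lambda>e. f e * qpow e \<tau>) summable_on UNIV"

lemma has_sum_geval: "gconv f \<tau> \<Longrightarrow> ((\<lambda>e. f e * qpow e \<tau>) has_sum geval f \<tau>) UNIV"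
  by (simp add: gconv_def geval_def)

lemma geval_eqI: "((\<lambda>e. f e * qpow e \<tau>) has_sum s) UNIV \<Longrightarrow> gconv f \<tau> \<and> geval f \<tau> = s"
  unfolding gconv_def geval_def by (auto simp: infsumI intro: has_sum_imp_summable)

lemma gconv_norm: "gconv f \<tau> \<longleftrightarrow> (\<lambda>e. cmod (f e * qpow e \<tau>)) summable_on UNIV"
  unfolding gconv_def by (rule summable_on_iff_abs_summable_on_complex)

text \<open>Fubini over the fibres of \<open>\<phi>\<close>: collecting the terms with equal
  exponent turns an indexed sum of powers of q into a series in the sense of \<open>gser\<close>.
  Finite fibres make the inner sums ordinary ones.\<close>

lemma has_sum_regroup:
  assumes "((\<lambda>i. a i * qpow (\<phi> i) \<tau>) has_sum s) I"
    and "\<And>e. finite {i \<in> I. \<phi> i = e}"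
  shows "((\<lambda>e. (\<Sum>i\<in>{i \<in> I. \<phi> i = e}. a i) * qpow e \<tau>) has_sum s) UNIV"
proof (rule has_sum_SigmaD[where B = "\<lambda>e. {i \<in> I. \<phi> i = e}"])
  show "((\<lambda>(e, i). a i * qpow e \<tau>) has_sum s) (SIGMA e:UNIV. {i \<in> I. \<phi> i = e})"
    using assms(1)
    by (subst has_sum_reindex_bij_witness[where i = "\<lambda>i. (\<phi> i, i)" and j = snd
          and T = I and h = "\<lambda>i. a i * qpow (\<phi> i) \<tau>" and s' = s]) auto
  fix e :: complex
  have "((\<lambda>i. a i * qpow e \<tau>) has_sum (\<Sum>i\<in>{i \<in> I. \<phi> i = e}. a i * qpow e \<tau>)) {i \<in> I. \<phi> i = e}"
    using assms(2) by (rule has_sum_finite)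
  thus "((\<lambda>i. case (e, i) of (e, i) \<Rightarrow> a i * qpow e \<tau>) has_sum
         (\<Sum>i\<in>{i \<in> I. \<phi> i = e}. a i) * qpow e \<tau>) {i \<in> I. \<phi> i = e}"
    by (simp add: sum_distrib_right)
qed

lemma summable_on_mult_Times:
  fixes F :: "'a \<Rightarrow> real" and G :: "'b \<Rightarrow> real"
  assumes "F summable_on A" "G summable_on B" "\<And>a. a \<in> A \<Longrightarrow> F a \<ge> 0" "\<And>b. b \<in> B \<Longrightarrow> G b \<ge> 0"
  shows "(\<lambda>(a, b). F a * G b) summable_on A \<times> B"
  using assms
  by (intro summable_on_SigmaI[where g = "\<lambda>a. F a * infsum G B"])
     (auto intro!: has_sum_cmult_right summable_on_cmult_left)

text \<open>One absolutely convergent double sum is evaluated twice: by rows it is the product of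
  the values, along the lines a + b = e it is the product series. Finiteness of these lines matters,
  as the sum in \<open>gmul\<close> is 0 by default on an infinite index set.\<close>

lemma geval_gmul:
  assumes "gconv f \<tau>" "gconv g \<tau>"
    and "\<And>e. finite {(a, b). a + b = e \<and> f a \<noteq> 0 \<and> g b \<noteq> 0}"
  shows "gconv (gmul f g) \<tau> \<and> geval (gmul f g) \<tau> = geval f \<tau> * geval g \<tau>"
proof -
  let ?F = "\<lambda>a. f a * qpow a \<tau>" and ?G = "\<lambda>b. g b * qpow b \<tau>"
  have "(\<lambda>p. norm (case p of (a, b) \<Rightarrow> ?F a * ?G b)) summable_on UNIV \<times> UNIV"
    using summable_on_mult_Times[OF assms(1,2)[unfolded gconv_norm]]
    by (simp add: case_prod_unfold norm_mult)
  hence sm: "(\<lambda>(a, b). ?F a * ?G b) summable_on UNIV \<times> UNIV"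
    by (rule abs_summable_summable)
  then obtain s where s: "((\<lambda>(a, b). ?F a * ?G b) has_sum s) (UNIV \<times> UNIV)"
    by (auto simp: summable_on_def)
  have "((\<lambda>a. ?F a * geval g \<tau>) has_sum s) UNIV"
    using has_sum_cmult_right[OF has_sum_geval[OF assms(2)]]
    by (intro has_sum_SigmaD[OF s]) simp
  moreover have "((\<lambda>a. ?F a * geval g \<tau>) has_sum (geval f \<tau> * geval g \<tau>)) UNIV"
    by (intro has_sum_cmult_left has_sum_geval assms)
  ultimately have s_eq: "s = geval f \<tau> * geval g \<tau>" by (rule has_sum_unique)
  let ?I = "{a. f a \<noteq> 0} \<times> {b. g b \<noteq> 0}"
  have "((\<lambda>p. f (fst p) * g (snd p) * qpow (fst p + snd p) \<tau>) has_sum s) ?I"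
    by (rule iffD1[OF has_sum_cong_neutral s]) (auto simp: qpow_add)
  moreover have fib: "{p \<in> ?I. fst p + snd p = e} = {(a, b). a + b = e \<and> f a \<noteq> 0 \<and> g b \<noteq> 0}" for e
    by auto
  ultimately have "((\<lambda>e. (\<Sum>p\<in>{p \<in> ?I. fst p + snd p = e}. f (fst p) * g (snd p)) * qpow e \<tau>)
                     has_sum s) UNIV"
    using assms(3) by (intro has_sum_regroup) auto
  hence "((\<lambda>e. gmul f g e * qpow e \<tau>) has_sum s) UNIV"
    unfolding gmul_def fib by (simp add: case_prod_unfold)
  from geval_eqI[OF this] show ?thesis by (simp add: s_eq)
qed

lemma geval_add:
  assumes "gconv f \<tau>" "gconv g \<tau>"
  shows "gconv (\<lambda>e. f e + g e) \<tau> \<and> geval (\<lambda>e. f e + g e) \<tau> = geval f \<tau> + geval g \<tau>"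
  using has_sum_add[OF assms[THEN has_sum_geval]]
  by (intro geval_eqI) (simp add: algebra_simps)

lemma geval_cmult:
  assumes "gconv f \<tau>"
  shows "gconv (\<lambda>e. c * f e) \<tau> \<and> geval (\<lambda>e. c * f e) \<tau> = c * geval f \<tau>"
  using has_sum_cmult_right[OF assms[THEN has_sum_geval], of c]
  by (intro geval_eqI) (simp add: algebra_simps)

lemma geval_sum:
  assumes "\<And>i. i \<in> I \<Longrightarrow> gconv (f i) \<tau>" "finite I"
  shows "gconv (\<lambda>e. \<Sum>i\<in>I. f i e) \<tau> \<and> geval (\<lambda>e. \<Sum>i\<in>I. f i e) \<tau> = (\<Sum>i\<in>I. geval (f i) \<tau>)"
  using assms(2,1)
proof (induction I rule: finite_induct)
  case empty
  show ?case by (simp add: gconv_def geval_def)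
next
  case (insert i I)
  thus ?case using geval_add[of "f i" \<tau> "\<lambda>e. \<Sum>i\<in>I. f i e"] by simp
qed

section \<open>Termwise differentiation\<close>

text \<open>The size of q^e decreases with Im \<tau> when Re e is positive, so on a disc it is
  controlled by the value at the lowest point. Bounded negative real parts and bounded imaginary
  parts of e cost only a constant: 2cr and cr in the exponent, times 2 pi.\<close>

lemma norm_qpow_le_shift:
  assumes "Re e \<ge> - c" "\<bar>Im e\<bar> \<le> c" "dist \<tau>0 \<tau> \<le> r" "c \<ge> 0"
  shows "cmod (qpow e \<tau>) \<le> exp (6 * pi * c * r) * cmod (qpow e (\<tau>0 - r * \<i>))"
proof -
  have 1: "\<bar>Re (\<tau>0 - \<tau>)\<bar> \<le> r" "\<bar>Im (\<tau>0 - \<tau>)\<bar> \<le> r"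
    using assms(3) abs_Re_le_cmod[of "\<tau>0 - \<tau>"] abs_Im_le_cmod[of "\<tau>0 - \<tau>"] by (simp_all add: dist_norm)
  have r: "r \<ge> 0" using assms(3) zero_le_dist order_trans by blast
  have "- (Re e * (Im \<tau> - Im \<tau>0 + r)) \<le> c * (Im \<tau> - Im \<tau>0 + r)"
    using mult_right_mono[of "- Re e" c "Im \<tau> - Im \<tau>0 + r"] assms(1) 1 by auto
  also have "\<dots> \<le> c * (2 * r)" using 1 assms(4) by (intro mult_left_mono) auto
  finally have A: "- (Re e * (Im \<tau> - Im \<tau>0 + r)) \<le> 2 * c * r" by simp
  have "- (Im e * (Re \<tau> - Re \<tau>0)) \<le> \<bar>Im e\<bar> * \<bar>Re (\<tau>0 - \<tau>)\<bar>"
    by (metis (no_types) abs_ge_minus_self abs_minus_commute abs_mult minus_complex.simps(1))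
  also have "\<dots> \<le> c * r" using 1 assms by (intro mult_mono) auto
  finally have B: "- (Im e * (Re \<tau> - Re \<tau>0)) \<le> c * r" .
  have "- (2 * pi * (Re e * Im \<tau> + Im e * Re \<tau>))
      = 2 * pi * (- (Re e * (Im \<tau> - Im \<tau>0 + r)) + - (Im e * (Re \<tau> - Re \<tau>0)))
        + - (2 * pi * (Re e * (Im \<tau>0 - r) + Im e * Re \<tau>0))"
    by (simp add: algebra_simps)
  also have "\<dots> \<le> 2 * pi * (2 * c * r + c * r) + - (2 * pi * (Re e * (Im \<tau>0 - r) + Im e * Re \<tau>0))"
    using A B by (intro add_right_mono mult_left_mono add_mono) auto
  also have "\<dots> = 6 * pi * c * r + - (2 * pi * (Re e * (Im \<tau>0 - r) + Im e * Re \<tau>0))"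
    by (simp add: algebra_simps)
  finally show ?thesis
    unfolding norm_qpow exp_add[symmetric] by simp
qed

text \<open>By the shift estimate, the terms at the lowest point of a disc majorise those on the
  whole disc, so the finite partial sums converge uniformly there and may be differentiated in the
  limit.\<close>

lemma geval_has_derivative:
  assumes supp: "\<And>e. f e \<noteq> 0 \<Longrightarrow> Re e \<ge> - c \<and> \<bar>Im e\<bar> \<le> c" and c: "c \<ge> 0"
    and conv: "\<And>\<tau>. \<tau> \<in> uhp \<Longrightarrow> gconv f \<tau>" and t: "\<tau>0 \<in> uhp"
  shows "gconv (gder f) \<tau>0"
    and "(geval f has_field_derivative 2 * pi * \<i> * geval (gder f) \<tau>0) (at \<tau>0)"
proof -
  define r where "r = Im \<tau>0 / 2"
  have r: "r > 0" and t1: "\<tau>0 - r * \<i> \<in> uhp" using t by (auto simp: r_def uhp_def)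
  let ?F = "finite_subsets_at_top (UNIV :: complex set)"
  have bd: "cmod (f e * qpow e \<tau>) \<le> exp (6 * pi * c * r) * cmod (f e * qpow e (\<tau>0 - r * \<i>))"
    if "\<tau> \<in> cball \<tau>0 r" for e \<tau>
  proof (cases "f e = 0")
    case False
    have "cmod (f e) * cmod (qpow e \<tau>) \<le> cmod (f e) * (exp (6 * pi * c * r) * cmod (qpow e (\<tau>0 - r * \<i>)))"
      using supp[OF False] that c by (intro mult_left_mono norm_qpow_le_shift) auto
    thus ?thesis by (simp add: norm_mult mult_ac)
  qed auto
  have "uniform_limit (cball \<tau>0 r) (\<lambda>X \<tau>. \<Sum>e\<in>X. f e * qpow e \<tau>)
          (\<lambda>\<tau>. \<Sum>\<^sub>\<infinity>e\<in>UNIV. f e * qpow e \<tau>) ?F"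
    using conv[OF t1] bd unfolding gconv_norm
    by (intro Weierstrass_m_test_general[where M = "\<lambda>e. exp (6 * pi * c * r) * cmod (f e * qpow e (\<tau>0 - r * \<i>))"]
          summable_on_cmult_right) auto
  hence ul: "uniform_limit (cball \<tau>0 r) (\<lambda>X \<tau>. \<Sum>e\<in>X. f e * qpow e \<tau>) (geval f) ?F"
    by (simp add: geval_def[abs_def])
  have der: "((\<lambda>\<tau>. \<Sum>e\<in>X. f e * qpow e \<tau>) has_field_derivative (\<Sum>e\<in>X. f e * (2 * pi * \<i> * e * qpow e w))) (at w within A)"
    for X w A by (intro derivative_intros DERIV_cmult has_field_derivative_qpow)
  have "eventually (\<lambda>X. continuous_on (cball \<tau>0 r) (\<lambda>\<tau>. \<Sum>e\<in>X. f e * qpow e \<tau>) \<and>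
     (\<forall>w\<in>ball \<tau>0 r. ((\<lambda>\<tau>. \<Sum>e\<in>X. f e * qpow e \<tau>) has_field_derivative (\<Sum>e\<in>X. f e * (2 * pi * \<i> * e * qpow e w))) (at w))) ?F"
    using der by (intro always_eventually) (auto intro!: DERIV_continuous_on)
  from has_complex_derivative_uniform_limit[OF this ul finite_subsets_at_top_neq_bot r]
  obtain g' where g': "\<And>w. w \<in> ball \<tau>0 r \<Longrightarrow> (geval f has_field_derivative g' w) (at w) \<and>
      ((\<lambda>X. \<Sum>e\<in>X. f e * (2 * pi * \<i> * e * qpow e w)) \<longlongrightarrow> g' w) ?F"
    by metis
  have "\<tau>0 \<in> ball \<tau>0 r" using r by simp
  note lim = g'[OF this]
  \<comment> \<open>The derivatives of the partial sums converge along the filter of finite sets,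
    which is precisely summability of the differentiated series; no separate estimate for
    \<open>gder f\<close> is required.\<close>
  have "((\<lambda>e. f e * (2 * pi * \<i> * e * qpow e \<tau>0)) has_sum g' \<tau>0) UNIV"
    using lim unfolding has_sum_def by blast
  hence "((\<lambda>e. 1 / (2 * pi * \<i>) * (f e * (2 * pi * \<i> * e * qpow e \<tau>0))) has_sum (1 / (2 * pi * \<i>) * g' \<tau>0)) UNIV"
    by (rule has_sum_cmult_right)
  hence "((\<lambda>e. gder f e * qpow e \<tau>0) has_sum (g' \<tau>0 / (2 * pi * \<i>))) UNIV"
    by (simp add: gder_def mult_ac)
  note * = geval_eqI[OF this]
  show "gconv (gder f) \<tau>0" using * by simp
  have "2 * pi * \<i> * geval (gder f) \<tau>0 = g' \<tau>0" using * by simp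
  thus "(geval f has_field_derivative 2 * pi * \<i> * geval (gder f) \<tau>0) (at \<tau>0)"
    using lim by simp
qed

section \<open>Eisenstein series and the series Q\<close>

lemma has_sum_const_at_0: "((\<lambda>e. (if e = 0 then c else 0) * qpow e \<tau>) has_sum c) UNIV"
  by (rule has_sum_finite_neutralI[where B = "{0}"]) auto

lemma norm_divsum_le: "cmod (divsum k (Suc n)) \<le> real (Suc n) ^ Suc k"
proof -
  have "{d. d dvd Suc n} \<subseteq> {1..Suc n}"
    using dvd_imp_le[of _ "Suc n"] dvd_pos_nat[of "Suc n"] by (force simp: Suc_le_eq)
  hence "card {d. d dvd Suc n} \<le> Suc n"
    by (metis card_atLeastAtMost card_mono diff_Suc_1 finite_atLeastAtMost)
  moreover have "cmod (divsum k (Suc n)) \<le> (\<Sum>d\<in>{d. d dvd Suc n}. real (Suc n) ^ k)"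
    unfolding divsum_def
    by (intro sum_norm_le) (auto simp: norm_power intro!: power_mono dest: dvd_imp_le)
  moreover have "real (card {d. d dvd Suc n}) * real (Suc n) ^ k \<le> real (Suc n) * real (Suc n) ^ k"
    using \<open>card {d. d dvd Suc n} \<le> Suc n\<close> by (intro mult_right_mono) auto
  ultimately have "cmod (divsum k (Suc n)) \<le> real (Suc n) * real (Suc n) ^ k"
    unfolding sum_constant by linarith
  thus ?thesis by simp
qed

text \<open>Divisor sums grow polynomially, so the terms are absolutely summable. The sum over n is
  moved to complex exponents along n |-> n + 1, and the constant term at exponent 0 is added
  separately.\<close>

lemma geval_eis:
  assumes "\<tau> \<in> uhp"
  shows "gconv (eis_q k) \<tau> \<and> geval (eis_q k) \<tau> = eis k \<tau>"
proof -
  define p where "p = 2 * k - 1"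
  define b where "b n = divsum p (Suc n) * qpow (of_nat (Suc n)) \<tau>" for n
  define C where "C = fact (Suc p) / (pi * Im \<tau>) ^ Suc p"
  have y: "Im \<tau> > 0" using assms by (simp add: uhp_def)
  have le: "norm (b n) \<le> C * exp (- (pi * Im \<tau> * real n))" for n
  proof -
    have "norm (b n) \<le> real (Suc n) ^ Suc p * cmod (qpow (of_real (real (Suc n))) \<tau>)"
      unfolding b_def norm_mult using norm_divsum_le[of p n] by (intro mult_mono) auto
    also have "\<dots> \<le> C * exp (- (pi * real (Suc n) * Im \<tau>))"
      using power_mult_norm_qpow_le[of "real (Suc n)" \<tau> "Suc p"] assms by (simp only: C_def of_nat_0_le_iff)
    also have "\<dots> \<le> C * exp (- (pi * Im \<tau> * real n))"
      using y by (intro mult_left_mono) (auto simp: C_def algebra_simps)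
    finally show ?thesis .
  qed
  have "summable (\<lambda>n. C * exp (- (pi * Im \<tau> * real n)))"
    using y by (intro summable_mult summable_exp_neg) auto
  hence sm: "summable (\<lambda>n. norm (b n))"
    by (rule summable_comparison_test'[where N = 0]) (simp add: le)
  have "(b has_sum suminf b) UNIV"
    by (rule norm_summable_imp_has_sum[OF sm summable_sums[OF summable_norm_cancel[OF sm]]])
  hence "((\<lambda>n. 2 / fact p * b n) has_sum (2 / fact p * suminf b)) UNIV"
    by (rule has_sum_cmult_right)
  moreover have "(\<lambda>n. 2 / fact p * b n) = (\<lambda>e. eis_q k e * qpow e \<tau>) \<circ> (\<lambda>n. of_nat (Suc n))"
  proof
    fix n
    have the: "(THE m. (of_nat (Suc n) :: complex) = of_nat m) = Suc n"
      by (rule the_equality) (simp_all only: of_nat_eq_iff)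
    show "2 / fact p * b n = ((\<lambda>e. eis_q k e * qpow e \<tau>) \<circ> (\<lambda>n. of_nat (Suc n))) n"
      by (simp only: o_def eis_q_def of_nat_eq_0_iff the b_def p_def of_nat_eq_iff) auto
  qed
  ultimately have "(((\<lambda>e. eis_q k e * qpow e \<tau>) \<circ> (\<lambda>n. of_nat (Suc n))) has_sum (2 / fact p * suminf b)) UNIV"
    by simp
  hence "((\<lambda>e. eis_q k e * qpow e \<tau>) has_sum (2 / fact p * suminf b)) (range (\<lambda>n. of_nat (Suc n)))"
    by (subst has_sum_reindex) (auto simp: inj_on_def)
  also have "?this \<longleftrightarrow> ((\<lambda>e. (if e = 0 then 0 else eis_q k e) * qpow e \<tau>) has_sum (2 / fact p * suminf b)) UNIV"
  proof (intro has_sum_cong_neutral)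
    fix e assume "e \<in> UNIV - range (\<lambda>n. of_nat (Suc n) :: complex)"
    hence "\<not> (\<exists>n. n > 0 \<and> e = of_nat n)" by (auto simp: gr0_conv_Suc)
    hence "eis_q k e = (if e = 0 then - bernpoly (2*k) 0 / fact (2*k) else 0)"
      unfolding eis_q_def by (simp only: if_False)
    thus "(if e = 0 then 0 else eis_q k e) * qpow e \<tau> = 0" by simp
  next
    fix e assume "e \<in> range (\<lambda>n. of_nat (Suc n) :: complex) \<inter> UNIV"
    thus "eis_q k e * qpow e \<tau> = (if e = 0 then 0 else eis_q k e) * qpow e \<tau>"
      by (auto simp del: of_nat_Suc)
  qed auto
  finally have "((\<lambda>e. (if e = 0 then - bernpoly (2*k) 0 / fact (2*k) else 0) * qpow e \<tau>
       + (if e = 0 then 0 else eis_q k e) * qpow e \<tau>)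
      has_sum (- bernpoly (2*k) 0 / fact (2*k) + 2 / fact p * suminf b)) UNIV"
    by (intro has_sum_add has_sum_const_at_0)
  also have "(\<lambda>e. (if e = 0 then - bernpoly (2*k) 0 / fact (2*k) else 0) * qpow e \<tau>
       + (if e = 0 then 0 else eis_q k e) * qpow e \<tau>) = (\<lambda>e. eis_q k e * qpow e \<tau>)"
    by (auto simp: eis_q_def)
  also have "- bernpoly (2*k) 0 / fact (2*k) + 2 / fact p * suminf b = eis k \<tau>"
    by (simp add: eis_def b_def[abs_def] p_def)
  finally show ?thesis by (rule geval_eqI)
qed

text \<open>Each quotient is a geometric series in m, giving an absolutely convergent double series
  over (n, m). Summing over m first returns the quotients; grouping by the exponent m(n + s) gives
  the q-expansion. The parameters s = r and s = -r, with N equal to 0 or 1, cover both halves of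
  Q_k.\<close>

lemma has_sum_lambert:
  fixes s :: real and N k :: nat and l :: complex
  assumes pos: "real N + s > 0" and l: "cmod l = 1" and t: "\<tau> \<in> uhp"
  defines "F \<equiv> \<lambda>n. l * of_real (real n + s) ^ k * qpow (of_real (real n + s)) \<tau>
                     / (1 - l * qpow (of_real (real n + s)) \<tau>)"
  defines "R \<equiv> \<lambda>e. {(n, m). n \<ge> N \<and> m \<ge> (1::nat) \<and> e = complex_of_real (real m * (real n + s))}"
  shows "summable (\<lambda>n. F (n + N))"
    and "((\<lambda>e. (\<Sum>(n, m)\<in>R e. l ^ m * of_real (real n + s) ^ k) * qpow e \<tau>)
            has_sum (\<Sum>n. F (n + N))) UNIV"
proof -
  define c where "c = real N + s"
  define x where "x n = real n + c" for n
  have x_pos: "x n > 0" for n using pos by (simp add: x_def c_def add_nonneg_pos)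
  have x_eq: "x n = real (n + N) + s" for n by (simp add: x_def c_def)
  have y: "Im \<tau> > 0" using t by (simp add: uhp_def)
  define G where "G = (\<lambda>(n::nat, m::nat). l ^ Suc m * of_real (x n) ^ k * qpow (of_real (real (Suc m) * x n)) \<tau>)"
  define C where "C = fact k / (pi * Im \<tau>) ^ k"
  have bound: "norm (G (n, m)) \<le> C * (exp (- (pi * Im \<tau> * real n)) * exp (- (pi * Im \<tau> * c * real m)))" for n m
  proof -
    have "x n ^ k \<le> (real (Suc m) * x n) ^ k"
      using x_pos[of n] by (intro power_mono) (auto simp: algebra_simps)
    hence "norm (G (n, m)) \<le> (real (Suc m) * x n) ^ k * cmod (qpow (of_real (real (Suc m) * x n)) \<tau>)"
      using l x_pos[of n] unfolding G_def prod.case norm_mult norm_power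
      by (intro mult_right_mono) (auto simp: less_imp_le)
    also have "\<dots> \<le> C * exp (- (pi * (real (Suc m) * x n) * Im \<tau>))"
      unfolding C_def using x_pos[of n] t by (intro power_mult_norm_qpow_le) (auto simp: less_imp_le)
    also have "\<dots> \<le> C * exp (- (pi * (real n + c * real m) * Im \<tau>))"
    proof -
      \<comment> \<open>Replacing the product m(n + c) by a sum lets the majorant split into a
        function of n times a function of m.\<close>
      have "real n + c * real m \<le> real (Suc m) * x n"
      proof -
        have "real (Suc m) * x n - (real n + c * real m) = c + real m * real n"
          by (simp add: x_def algebra_simps)
        moreover have "c \<ge> 0" "real m * real n \<ge> 0" using pos by (simp_all add: c_def)
        ultimately show ?thesis by linarith
      qed
      hence "pi * (real n + c * real m) * Im \<tau> \<le> pi * (real (Suc m) * x n) * Im \<tau>"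
        using y by (intro mult_right_mono mult_left_mono) auto
      thus ?thesis using y by (intro mult_left_mono) (auto simp: C_def)
    qed
    also have "exp (- (pi * (real n + c * real m) * Im \<tau>))
        = exp (- (pi * Im \<tau> * real n)) * exp (- (pi * Im \<tau> * c * real m))"
      by (simp add: algebra_simps flip: exp_add)
    finally show ?thesis .
  qed
  have "(\<lambda>(n, m). exp (- (pi * Im \<tau> * real n)) * exp (- (pi * Im \<tau> * c * real m))) summable_on UNIV \<times> UNIV"
    using y pos
    by (intro summable_on_mult_Times norm_summable_imp_summable_on)
       (auto simp: c_def intro!: summable_exp_neg)
  hence "(\<lambda>p. C * (case p of (n, m) \<Rightarrow> exp (- (pi * Im \<tau> * real n)) * exp (- (pi * Im \<tau> * c * real m)))) summable_on UNIV \<times> UNIV"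
    by (rule summable_on_cmult_right)
  hence "(\<lambda>p. norm (G p)) summable_on UNIV \<times> UNIV"
    by (rule summable_on_comparison_test) (use bound in auto)
  hence "G summable_on UNIV \<times> UNIV" by (rule abs_summable_summable)
  then obtain S where S: "(G has_sum S) (UNIV \<times> UNIV)" by (auto simp: summable_on_def)
  have "((\<lambda>n. F (n + N)) has_sum S) UNIV"
  proof (rule has_sum_SigmaD[OF S])
    fix n
    define z where "z = l * qpow (of_real (x n)) \<tau>"
    have nz: "norm z < 1"
      using x_pos[of n] y l by (simp add: z_def norm_mult norm_qpow_real)
    have "(\<lambda>m. of_real (x n) ^ k * z * z ^ m) sums (of_real (x n) ^ k * z * (1 / (1 - z)))"
      by (intro sums_mult geometric_sums nz)
    moreover have "summable (\<lambda>m. norm (of_real (x n) ^ k * z * z ^ m))"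
      using nz by (simp add: norm_mult norm_power summable_geometric summable_mult)
    ultimately have "((\<lambda>m. of_real (x n) ^ k * z * z ^ m) has_sum (of_real (x n) ^ k * z * (1 / (1 - z)))) UNIV"
      by (rule norm_summable_imp_has_sum[rotated])
    moreover have "of_real (x n) ^ k * z * z ^ m = G (n, m)" for m
    proof -
      have "z ^ Suc m = l ^ Suc m * qpow (of_real (real (Suc m) * x n)) \<tau>"
        unfolding z_def power_mult_distrib of_real_mult of_real_of_nat_eq qpow_of_nat_mult ..
      thus ?thesis by (simp add: G_def mult_ac)
    qed
    moreover have "of_real (x n) ^ k * z * (1 / (1 - z)) = F (n + N)"
      by (simp add: F_def z_def x_eq mult_ac)
    ultimately show "((\<lambda>m. G (n, m)) has_sum F (n + N)) UNIV" by simp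
  qed
  hence sums: "(\<lambda>n. F (n + N)) sums S" by (rule has_sum_imp_sums)
  thus "summable (\<lambda>n. F (n + N))" by (rule sums_summable)
  have S_eq: "S = (\<Sum>n. F (n + N))" using sums by (rule sums_unique)
  let ?I = "{N..} \<times> {1::nat..}"
  let ?a = "\<lambda>p. l ^ snd p * complex_of_real (real (fst p) + s) ^ k"
  let ?\<phi> = "\<lambda>p::nat \<times> nat. complex_of_real (real (snd p) * (real (fst p) + s))"
  have "((\<lambda>p. ?a p * qpow (?\<phi> p) \<tau>) has_sum S) ?I \<longleftrightarrow> (G has_sum S) (UNIV \<times> UNIV)"
    by (rule has_sum_reindex_bij_witness[where i = "\<lambda>(n, m). (n + N, Suc m)" and j = "\<lambda>(n, m). (n - N, m - 1)"])
       (auto simp: G_def x_def c_def Suc_le_eq simp flip: power_Suc)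
  hence reg: "((\<lambda>p. ?a p * qpow (?\<phi> p) \<tau>) has_sum S) ?I" using S by simp
  have R_eq: "{p \<in> ?I. ?\<phi> p = e} = R e" for e
    by (auto simp: R_def)
  have fin: "finite (R e)" for e
  proof (rule finite_subset)
    show "R e \<subseteq> {..N + nat \<lceil>Re e\<rceil>} \<times> {..nat \<lceil>Re e / c\<rceil>}"
    proof (clarsimp simp: R_def simp del: of_real_add of_real_mult)
      fix n m :: nat assume nm: "N \<le> n" "Suc 0 \<le> m"
      define d where "d = n - N"
      have n: "n = d + N" using nm by (simp add: d_def)
      have "real d \<le> real m * real d" using nm mult_right_mono[of 1 "real m" "real d"] by simp
      hence "real d + real m * c \<le> real m * (real n + s)"
        by (simp add: n c_def algebra_simps)
      moreover have "real m * c \<ge> 0" using pos by (simp add: c_def)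
      ultimately have "real d \<le> real m * (real n + s)" "real m * c \<le> real m * (real n + s)" by linarith+
      thus "n \<le> N + nat \<lceil>real m * (real n + s)\<rceil> \<and> m \<le> nat \<lceil>real m * (real n + s) / c\<rceil>"
        using pos unfolding n c_def[symmetric] by (simp add: le_nat_iff le_ceiling_iff real_nat_ceiling_ge field_simps)
    qed
  qed auto
  have "((\<lambda>e. (\<Sum>p\<in>{p \<in> ?I. ?\<phi> p = e}. ?a p) * qpow e \<tau>) has_sum S) UNIV"
    by (rule has_sum_regroup[OF reg]) (simp only: R_eq fin)
  thus "((\<lambda>e. (\<Sum>(n, m)\<in>R e. l ^ m * of_real (real n + s) ^ k) * qpow e \<tau>)
            has_sum (\<Sum>n. F (n + N))) UNIV"
    unfolding R_eq S_eq by (simp add: case_prod_unfold)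
qed

text \<open>Both halves are Lambert series; what remains are contributions at exponent 0, namely the
  Bernoulli term and, for r = 0, the summand n = 0 of the first half.\<close>

lemma geval_Q:
  assumes r: "0 \<le> r" "r < 1" and l: "cmod lam = 1" and nontriv: "r \<noteq> 0 \<or> lam \<noteq> 1" and t: "\<tau> \<in> uhp"
  shows "gconv (Q_q k r lam) \<tau> \<and> geval (Q_q k r lam) \<tau> = Qfun k r lam \<tau>"
proof (cases "k = 0")
  case True
  hence "(\<lambda>e. Q_q k r lam e * qpow e \<tau>) = (\<lambda>e. (if e = 0 then -1 else 0) * qpow e \<tau>)"
    by (auto simp: Q_q_def)
  hence "((\<lambda>e. Q_q k r lam e * qpow e \<tau>) has_sum -1) UNIV"
    by (simp only: has_sum_const_at_0)
  from geval_eqI[OF this] show ?thesis using True by (simp add: Qfun_def)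
next
  case False
  define F where "F = (\<lambda>n. lam * of_real (real n + r) ^ (k-1) * qpow (of_real (real n + r)) \<tau>
                     / (1 - lam * qpow (of_real (real n + r)) \<tau>))"
  define H where "H = (\<lambda>n. inverse lam * of_real (real n - r) ^ (k-1) * qpow (of_real (real n - r)) \<tau>
                     / (1 - inverse lam * qpow (of_real (real n - r)) \<tau>))"
  define A where "A (e::complex) = (\<Sum>(n,m)\<in>{(n,m). (n::nat) \<ge> 0 \<and> (m::nat) \<ge> 1 \<and> real n + r > 0
                         \<and> e = of_real (real m * (real n + r))}. lam ^ m * (of_real (real n + r) :: complex) ^ (k-1))" for e
  define B where "B (e::complex) = (\<Sum>(n,m)\<in>{(n,m). (n::nat) \<ge> 1 \<and> (m::nat) \<ge> 1 \<and> e = of_real (real m * (real n - r))}.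
            (inverse lam) ^ m * (of_real (real n - r) :: complex) ^ (k-1))" for e
  define c0 where "c0 = (if r = 0 then lam * 0 ^ (k-1) / (1 - lam) else 0)"
  define b where "b = bernpoly k (of_real r) / fact k"
  have Bsum: "((\<lambda>e. B e * qpow e \<tau>) has_sum (\<Sum>n. H (Suc n))) UNIV"
    using has_sum_lambert(2)[where N = 1 and s = "-r" and l = "inverse lam" and k = "k-1", OF _ _ t] r l
    by (simp add: B_def[abs_def] H_def norm_inverse)
  have Asum: "((\<lambda>e. A e * qpow e \<tau> + (if e = 0 then c0 else 0) * qpow e \<tau>) has_sum (\<Sum>n. F n)) UNIV"
  proof (cases "r = 0")
    \<comment> \<open>For r = 0 the summand n = 0 has exponent 0 and cannot be expanded
      geometrically. The Lambert series starts at n = 1, and \<open>c0\<close> restores the missing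
      constant.\<close>
    case True
    have set: "{(n,m). (n::nat) \<ge> 0 \<and> (m::nat) \<ge> 1 \<and> real n + r > 0 \<and> e = complex_of_real (real m * (real n + r))}
       = {(n,m). (n::nat) \<ge> 1 \<and> (m::nat) \<ge> 1 \<and> e = complex_of_real (real m * (real n + r))}" for e
      using True by auto
    have "((\<lambda>e. A e * qpow e \<tau>) has_sum (\<Sum>n. F (n + 1))) UNIV" and sm: "summable (\<lambda>n. F (n + 1))"
      using has_sum_lambert[where N = 1 and s = r and l = lam and k = "k-1", OF _ l t] r
      unfolding A_def set F_def by simp_all
    hence "((\<lambda>e. A e * qpow e \<tau> + (if e = 0 then c0 else 0) * qpow e \<tau>) has_sum ((\<Sum>n. F (n + 1)) + c0)) UNIV"
      by (intro has_sum_add has_sum_const_at_0)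
    moreover have "suminf F = (\<Sum>n. F (n + 1)) + F 0"
      using sm suminf_split_initial_segment[of F 1] summable_iff_shift[of F 1] by simp
    moreover have "F 0 = c0" using True by (simp add: F_def c0_def)
    ultimately show ?thesis by simp
  next
    case False
    have set: "{(n,m). (n::nat) \<ge> 0 \<and> (m::nat) \<ge> 1 \<and> real n + r > 0 \<and> e = complex_of_real (real m * (real n + r))}
       = {(n,m). (n::nat) \<ge> 0 \<and> (m::nat) \<ge> 1 \<and> e = complex_of_real (real m * (real n + r))}" for e
      using False r by (auto simp: add_nonneg_pos)
    have "((\<lambda>e. A e * qpow e \<tau>) has_sum (\<Sum>n. F n)) UNIV"
      using has_sum_lambert(2)[where N = 0 and s = r and l = lam and k = "k-1", OF _ l t] r False
      unfolding A_def set F_def by simp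
    thus ?thesis using False by (simp add: c0_def cong: if_cong)
  qed
  have "((\<lambda>e. 1 / fact (k-1) * (A e * qpow e \<tau> + (if e = 0 then c0 else 0) * qpow e \<tau>)
            + (-1)^k / fact (k-1) * (B e * qpow e \<tau>) + (if e = 0 then - b else 0) * qpow e \<tau>)
        has_sum (1 / fact (k-1) * (\<Sum>n. F n) + (-1)^k / fact (k-1) * (\<Sum>n. H (Suc n)) + - b)) UNIV"
    by (intro has_sum_add has_sum_cmult_right Asum Bsum has_sum_const_at_0)
  also have "(\<lambda>e. 1 / fact (k-1) * (A e * qpow e \<tau> + (if e = 0 then c0 else 0) * qpow e \<tau>)
            + (-1)^k / fact (k-1) * (B e * qpow e \<tau>) + (if e = 0 then - b else 0) * qpow e \<tau>)
      = (\<lambda>e. Q_q k r lam e * qpow e \<tau>)"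
  proof
    fix e
    have "Q_q k r lam e = 1 / fact (k-1) * (A e + (if e = 0 then c0 else 0)) + (-1)^k / fact (k-1) * B e
            + (if e = 0 then - b else 0)"
      using False by (simp add: Q_q_def A_def B_def c0_def b_def)
    thus "1 / fact (k-1) * (A e * qpow e \<tau> + (if e = 0 then c0 else 0) * qpow e \<tau>)
            + (-1)^k / fact (k-1) * (B e * qpow e \<tau>) + (if e = 0 then - b else 0) * qpow e \<tau>
        = Q_q k r lam e * qpow e \<tau>"
      by (simp add: algebra_simps)
  qed
  also have "1 / fact (k-1) * (\<Sum>n. F n) + (-1)^k / fact (k-1) * (\<Sum>n. H (Suc n)) + - b = Qfun k r lam \<tau>"
    using False by (simp add: Qfun_def F_def H_def b_def)
  finally show ?thesis by (rule geval_eqI)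
qed

section \<open>Exponents of the Eisenstein series and of the series Q\<close>

definition nonneg_supp :: "nat \<Rightarrow> gser \<Rightarrow> bool" where
  "nonneg_supp T f \<longleftrightarrow> (\<forall>e. f e \<noteq> 0 \<longrightarrow> (\<exists>n::nat. e = of_nat n / of_nat T))"

lemma nonneg_supp_eis:
  assumes "T > 0"
  shows "nonneg_supp T (eis_q k)"
  unfolding nonneg_supp_def
proof (intro allI impI)
  fix e assume "eis_q k e \<noteq> 0"
  hence "e = 0 \<or> (\<exists>n. n > 0 \<and> e = of_nat n)" by (auto simp: eis_q_def split: if_splits)
  then obtain n where "e = of_nat n" by (metis of_nat_0)
  thus "\<exists>n::nat. e = of_nat n / of_nat T"
    using assms by (intro exI[of _ "n * T"]) simp
qed

lemma nonneg_supp_Q: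
  assumes "j < T"
  shows "nonneg_supp T (Q_q k (real j / real T) lam)"
  unfolding nonneg_supp_def
proof (intro allI impI)
  fix e
  assume nz: "Q_q k (real j / real T) lam e \<noteq> 0"
  let ?A = "{(n,m). (n::nat) \<ge> 0 \<and> (m::nat) \<ge> 1 \<and> real n + real j / real T > 0
                         \<and> e = complex_of_real (real m * (real n + real j / real T))}"
  let ?B = "{(n,m). (n::nat) \<ge> 1 \<and> (m::nat) \<ge> 1 \<and> e = complex_of_real (real m * (real n - real j / real T))}"
  consider "e = 0" | "?A \<noteq> {}" | "?B \<noteq> {}"
  proof (cases "e = 0 \<or> ?A \<noteq> {} \<or> ?B \<noteq> {}")
    case False
    hence "e \<noteq> 0" and A: "?A = {}" and B: "?B = {}" by blast+
    hence "Q_q k (real j / real T) lam e = 0" unfolding Q_q_def A B by simp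
    thus thesis using nz by contradiction
  qed (use that in blast)
  thus "\<exists>n::nat. e = of_nat n / of_nat T"
  proof cases
    case 1
    thus ?thesis by (intro exI[of _ 0]) simp
  next
    case 2
    then obtain n m :: nat where "e = complex_of_real (real m * (real n + real j / real T))" by auto
    also have "\<dots> = of_nat (m * (n * T + j)) / of_nat T" using assms by (simp add: field_simps)
    finally show ?thesis by blast
  next
    case 3
    then obtain n m :: nat where n: "n \<ge> 1" and e: "e = complex_of_real (real m * (real n - real j / real T))" by auto
    have "j \<le> n * T" using n assms by (metis less_imp_le mult_le_mono1 nat_mult_1 order_trans)
    hence *: "real (n * T - j) = real n * real T - real j" by (simp add: of_nat_diff)
    have "real m * (real n - real j / real T) = real (m * (n * T - j)) / real T"
      unfolding of_nat_mult * using assms by (simp add: field_simps)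
    hence "e = of_nat (m * (n * T - j)) / of_nat T" unfolding e by simp
    thus ?thesis by blast
  qed
qed

section \<open>Dominated series\<close>

text \<open>Bounding all finite partial sums below the cutoff x makes sense for any coefficient
  function, before anything is known about its support or convergence. The constant C is independent
  of x; this uniformity drives the whole argument.\<close>

definition dominated :: "complex \<Rightarrow> (real \<Rightarrow> real) \<Rightarrow> gser \<Rightarrow> bool" where
  "dominated \<tau> M f \<longleftrightarrow> (\<exists>C\<ge>0. \<forall>x A. finite A \<longrightarrow> (\<forall>e\<in>A. Re e \<le> x) \<longrightarrow>
      (\<Sum>e\<in>A. cmod (f e * qpow e \<tau>)) \<le> C * M x)"

lemma dominatedI:
  assumes "C \<ge> 0" "\<And>x A. finite A \<Longrightarrow> (\<And>e. e \<in> A \<Longrightarrow> Re e \<le> x) \<Longrightarrow>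
             (\<Sum>e\<in>A. cmod (f e * qpow e \<tau>)) \<le> C * M x"
  shows "dominated \<tau> M f"
  unfolding dominated_def using assms by (intro exI[of _ C]) auto

lemma dominated_0: "dominated \<tau> M (\<lambda>e. 0)"
  by (rule dominatedI[of 0]) auto

lemma dominated_add:
  assumes "dominated \<tau> M f" "dominated \<tau> M g"
  shows "dominated \<tau> M (\<lambda>e. f e + g e)"
proof -
  obtain C where C: "C \<ge> 0" "\<forall>x A. finite A \<longrightarrow> (\<forall>e\<in>A. Re e \<le> x) \<longrightarrow>
             (\<Sum>e\<in>A. cmod (f e * qpow e \<tau>)) \<le> C * M x"
    using assms(1) unfolding dominated_def by blast
  obtain D where D: "D \<ge> 0" "\<forall>x A. finite A \<longrightarrow> (\<forall>e\<in>A. Re e \<le> x) \<longrightarrow>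
             (\<Sum>e\<in>A. cmod (g e * qpow e \<tau>)) \<le> D * M x"
    using assms(2) unfolding dominated_def by blast
  show ?thesis
  proof (rule dominatedI[of "C + D"])
    fix x A assume A: "finite A" "\<And>e. e \<in> A \<Longrightarrow> Re e \<le> x"
    have "(\<Sum>e\<in>A. cmod ((f e + g e) * qpow e \<tau>))
        \<le> (\<Sum>e\<in>A. cmod (f e * qpow e \<tau>) + cmod (g e * qpow e \<tau>))"
      unfolding distrib_right by (intro sum_mono norm_triangle_ineq)
    also have "\<dots> \<le> C * M x + D * M x"
      unfolding sum.distrib using C(2) D(2) A by (intro add_mono) auto
    finally show "(\<Sum>e\<in>A. cmod ((f e + g e) * qpow e \<tau>)) \<le> (C + D) * M x"
      by (simp add: distrib_right)
  qed (use C D in auto)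
qed

lemma dominated_cmult:
  assumes "dominated \<tau> M f"
  shows "dominated \<tau> M (\<lambda>e. c * f e)"
proof -
  obtain C where C: "C \<ge> 0" "\<forall>x A. finite A \<longrightarrow> (\<forall>e\<in>A. Re e \<le> x) \<longrightarrow>
             (\<Sum>e\<in>A. cmod (f e * qpow e \<tau>)) \<le> C * M x"
    using assms(1) unfolding dominated_def by blast
  show ?thesis
  proof (rule dominatedI[of "cmod c * C"])
    fix x A assume A: "finite A" "\<And>e. e \<in> A \<Longrightarrow> Re e \<le> x"
    have "(\<Sum>e\<in>A. cmod (c * f e * qpow e \<tau>)) = cmod c * (\<Sum>e\<in>A. cmod (f e * qpow e \<tau>))"
      by (simp add: norm_mult sum_distrib_left mult_ac)
    also have "\<dots> \<le> cmod c * (C * M x)" using C A by (intro mult_left_mono) auto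
    finally show "(\<Sum>e\<in>A. cmod (c * f e * qpow e \<tau>)) \<le> cmod c * C * M x" by simp
  qed (use C in auto)
qed

lemma dominated_sum:
  assumes "\<And>i. i \<in> I \<Longrightarrow> dominated \<tau> M (f i)"
  shows "dominated \<tau> M (\<lambda>e. \<Sum>i\<in>I. f i e)"
  using assms
  by (induction I rule: infinite_finite_induct) (auto intro: dominated_0 dominated_add)

lemma Re_Im_of_nat_divide:
  "Re (of_nat n / of_nat T) = real n / real T" "Im (of_nat n / of_nat T) = 0"
proof -
  have "of_nat n / of_nat T = complex_of_real (real n / real T)" by simp
  thus "Re (of_nat n / of_nat T) = real n / real T" "Im (of_nat n / of_nat T) = 0"
    by (simp_all only: Re_complex_of_real Im_complex_of_real)
qed

lemma nonneg_suppD: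
  assumes "nonneg_supp T f" "f e \<noteq> 0"
  shows "Re e \<ge> 0"
proof -
  obtain n :: nat where "e = of_nat n / of_nat T"
    using assms unfolding nonneg_supp_def by blast
  thus ?thesis by (simp add: Re_Im_of_nat_divide)
qed

lemma dominated_gmul:
  assumes E: "gconv E \<tau>" "nonneg_supp T E" and f: "dominated \<tau> M f"
  shows "dominated \<tau> M (gmul E f)"
proof -
  obtain C where C: "C \<ge> 0" "\<forall>x A. finite A \<longrightarrow> (\<forall>e\<in>A. Re e \<le> x) \<longrightarrow>
             (\<Sum>e\<in>A. cmod (f e * qpow e \<tau>)) \<le> C * M x"
    using f unfolding dominated_def by blast
  define u where "u a = cmod (E a * qpow a \<tau>)" for a
  define v where "v b = cmod (f b * qpow b \<tau>)" for b
  define K where "K = infsum u UNIV"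
  have u: "u summable_on UNIV" "\<And>a. u a \<ge> 0" using E(1) by (auto simp: gconv_norm u_def[abs_def])
  have v: "\<And>b. v b \<ge> 0" by (simp add: v_def)
  have K: "K \<ge> 0" unfolding K_def using u by (intro infsum_nonneg)
  define P where "P e = {(a, b). a + b = e \<and> E a \<noteq> 0 \<and> f b \<noteq> 0}" for e
  show ?thesis
  proof (rule dominatedI[of "K * C"])
    fix x A assume A: "finite A" "\<And>e. e \<in> A \<Longrightarrow> Re e \<le> x"
    define A' where "A' = {e \<in> A. finite (P e)}"
    define U where "U = (\<Union>e\<in>A'. P e)"
    have A': "finite A'" using A by (simp add: A'_def)
    have U: "finite U" using A' by (auto simp: U_def A'_def)
    have "(\<Sum>e\<in>A. cmod (gmul E f e * qpow e \<tau>)) = (\<Sum>e\<in>A'. cmod (gmul E f e * qpow e \<tau>))"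
      using A unfolding A'_def by (intro sum.mono_neutral_right) (auto simp: gmul_def P_def)
    also have "\<dots> \<le> (\<Sum>e\<in>A'. \<Sum>(a, b)\<in>P e. u a * v b)"
    proof (intro sum_mono)
      fix e
      have "gmul E f e * qpow e \<tau> = (\<Sum>(a, b)\<in>P e. E a * qpow a \<tau> * (f b * qpow b \<tau>))"
        unfolding gmul_def P_def[symmetric] sum_distrib_right
        by (intro sum.cong) (auto simp: P_def qpow_add)
      thus "cmod (gmul E f e * qpow e \<tau>) \<le> (\<Sum>(a, b)\<in>P e. u a * v b)"
        by (auto simp: u_def v_def norm_mult intro!: sum_norm_le)
    qed
    also have "\<dots> = (\<Sum>(a, b)\<in>U. u a * v b)"
      unfolding U_def using A' by (subst sum.UNION_disjoint) (auto simp: A'_def P_def)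
    \<comment> \<open>Enlarging the index set to a rectangle factors the sum. The second factor
      still respects the cutoff x, since exponents of \<open>E\<close> have nonnegative real part
      and so Re b \<le> Re e.\<close>
    also have "\<dots> \<le> (\<Sum>(a, b)\<in>fst ` U \<times> snd ` U. u a * v b)"
    proof (intro sum_mono2)
      show "U \<subseteq> fst ` U \<times> snd ` U" by force
    qed (use U u v in auto)
    also have "\<dots> = (\<Sum>a\<in>fst ` U. u a) * (\<Sum>b\<in>snd ` U. v b)"
      by (simp add: sum_product sum.cartesian_product)
    also have "\<dots> \<le> K * (C * M x)"
    proof (intro mult_mono)
      show "(\<Sum>a\<in>fst ` U. u a) \<le> K"
        unfolding K_def using u U by (intro finite_sum_le_infsum) auto
      show "(\<Sum>b\<in>snd ` U. v b) \<le> C * M x"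
        unfolding v_def
      proof (rule C(2)[rule_format])
        fix b assume "b \<in> snd ` U"
        then obtain e a where e: "e \<in> A" "a + b = e" "E a \<noteq> 0" by (auto simp: U_def P_def A'_def)
        have "Re a \<ge> 0" by (rule nonneg_suppD[OF E(2) e(3)])
        thus "Re b \<le> x" using A(2)[OF e(1)] e(2) by auto
      qed (use U in simp)
    qed (auto intro!: sum_nonneg v K)
    finally show "(\<Sum>e\<in>A. cmod (gmul E f e * qpow e \<tau>)) \<le> K * C * M x" by simp
  qed (use K C in auto)
qed

text \<open>The value is meaningful for series with finitely many exponents below each cutoff, which
  \<open>fser_ok_finite\<close> supplies for formal 1-point functions.\<close>

definition trunc_norm :: "complex \<Rightarrow> real \<Rightarrow> gser \<Rightarrow> real" where
  "trunc_norm \<tau> x f = (\<Sum>e\<in>{e. f e \<noteq> 0 \<and> Re e \<le> x}. cmod (f e * qpow e \<tau>))"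

lemma trunc_norm_nonneg: "trunc_norm \<tau> x f \<ge> 0"
  unfolding trunc_norm_def by (intro sum_nonneg) auto

lemma dominated_trunc_norm_sum:
  assumes "finite W" "f \<in> W" "\<And>x. finite {e. f e \<noteq> 0 \<and> Re e \<le> x}"
  shows "dominated \<tau> (\<lambda>x. \<Sum>g\<in>W. trunc_norm \<tau> x g) f"
proof (rule dominatedI[of 1])
  fix x A assume A: "finite A" "\<And>e. e \<in> A \<Longrightarrow> Re e \<le> x"
  have "(\<Sum>e\<in>A. cmod (f e * qpow e \<tau>)) = (\<Sum>e\<in>{e \<in> A. f e \<noteq> 0}. cmod (f e * qpow e \<tau>))"
    using A by (intro sum.mono_neutral_right) auto
  also have "\<dots> \<le> trunc_norm \<tau> x f"
    unfolding trunc_norm_def using A assms(3) by (intro sum_mono2) auto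
  also have "\<dots> \<le> (\<Sum>g\<in>W. trunc_norm \<tau> x g)"
    using assms trunc_norm_nonneg by (intro member_le_sum) auto
  finally show "(\<Sum>e\<in>A. cmod (f e * qpow e \<tau>)) \<le> 1 * (\<Sum>g\<in>W. trunc_norm \<tau> x g)" by simp
qed simp

text \<open>The Euler operator multiplies the coefficient of \<open>q^e\<close> by \<open>e\<close>. If it is bounded by \<open>C\<close> with
  respect to the truncated norms, the exponents with \<open>\<bar>e\<bar> > 2C\<close> contribute at most half of
  the truncated norm, uniformly in the truncation.\<close>

lemma gconv_if_gder_dominated:
  assumes W: "finite W" and fin: "\<And>f x. f \<in> W \<Longrightarrow> finite {e. f e \<noteq> 0 \<and> Re e \<le> x}"
    and der: "\<And>f. f \<in> W \<Longrightarrow> dominated \<tau> (\<lambda>x. \<Sum>g\<in>W. trunc_norm \<tau> x g) (gder f)"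
    and g: "dominated \<tau> (\<lambda>x. \<Sum>g\<in>W. trunc_norm \<tau> x g) g"
  shows "gconv g \<tau>"
proof -
  define M where "M x = (\<Sum>g\<in>W. trunc_norm \<tau> x g)" for x
  have M_nonneg: "M x \<ge> 0" for x unfolding M_def by (intro sum_nonneg trunc_norm_nonneg)
  have "\<forall>f\<in>W. \<exists>C\<ge>0. \<forall>x A. finite A \<longrightarrow> (\<forall>e\<in>A. Re e \<le> x) \<longrightarrow>
      (\<Sum>e\<in>A. cmod (gder f e * qpow e \<tau>)) \<le> C * M x"
    using der unfolding dominated_def M_def by blast
  then obtain C where C: "\<And>f. f \<in> W \<Longrightarrow> C f \<ge> 0"
    "\<And>f x A. f \<in> W \<Longrightarrow> finite A \<Longrightarrow> (\<And>e. e \<in> A \<Longrightarrow> Re e \<le> x) \<Longrightarrow>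
      (\<Sum>e\<in>A. cmod (gder f e * qpow e \<tau>)) \<le> C f * M x"
    by metis
  \<comment> \<open>The factor 2 makes the quotient (sum of the C f) / K at most 1/2; the summand 1
    keeps K positive when all constants vanish.\<close>
  define K where "K = 2 * (\<Sum>f\<in>W. C f) + 1"
  have CW: "(\<Sum>f\<in>W. C f) \<ge> 0" using C by (intro sum_nonneg)
  have K: "K > 0" using CW by (simp add: K_def)
  define small where "small f = {e. f e \<noteq> 0 \<and> cmod e \<le> K}" for f :: gser
  define M0 where "M0 = (\<Sum>f\<in>W. \<Sum>e\<in>small f. cmod (f e * qpow e \<tau>))"
  have bound: "M x \<le> 2 * M0" for x
  proof -
    have "trunc_norm \<tau> x f \<le> (\<Sum>e\<in>small f. cmod (f e * qpow e \<tau>)) + C f * M x / K" if f: "f \<in> W" for f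
    proof -
      let ?D = "{e. f e \<noteq> 0 \<and> Re e \<le> x}"
      have fD: "finite ?D" by (rule fin[OF f])
      have "small f \<subseteq> {e. f e \<noteq> 0 \<and> Re e \<le> K}"
        using complex_Re_le_cmod order_trans unfolding small_def by blast
      hence fs: "finite (small f)" using fin[OF f] finite_subset by blast
      have "trunc_norm \<tau> x f = (\<Sum>e\<in>?D \<inter> small f. cmod (f e * qpow e \<tau>)) + (\<Sum>e\<in>?D - small f. cmod (f e * qpow e \<tau>))"
        unfolding trunc_norm_def using fD by (rule sum.Int_Diff)
      also have "(\<Sum>e\<in>?D \<inter> small f. cmod (f e * qpow e \<tau>)) \<le> (\<Sum>e\<in>small f. cmod (f e * qpow e \<tau>))"
        using fs by (intro sum_mono2) auto
      also have "(\<Sum>e\<in>?D - small f. cmod (f e * qpow e \<tau>)) \<le> (\<Sum>e\<in>?D - small f. cmod (gder f e * qpow e \<tau>) / K)"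
      proof (intro sum_mono)
        fix e assume "e \<in> ?D - small f"
        hence "K \<le> cmod e" by (auto simp: small_def)
        hence "K * cmod (f e * qpow e \<tau>) \<le> cmod e * cmod (f e * qpow e \<tau>)"
          by (intro mult_right_mono) auto
        thus "cmod (f e * qpow e \<tau>) \<le> cmod (gder f e * qpow e \<tau>) / K"
          using K by (simp add: gder_def norm_mult field_simps)
      qed
      also have "\<dots> = (\<Sum>e\<in>?D - small f. cmod (gder f e * qpow e \<tau>)) / K"
        by (simp add: sum_divide_distrib)
      also have "\<dots> \<le> C f * M x / K"
        using K fD by (intro divide_right_mono C(2)[OF f]) auto
      finally show ?thesis by simp
    qed
    hence "M x \<le> (\<Sum>f\<in>W. (\<Sum>e\<in>small f. cmod (f e * qpow e \<tau>)) + C f * M x / K)"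
      unfolding M_def[of x] by (intro sum_mono) (simp flip: M_def)
    also have "\<dots> = M0 + (\<Sum>f\<in>W. C f) / K * M x"
      by (simp add: sum.distrib M0_def sum_divide_distrib sum_distrib_right)
    \<comment> \<open>For each x the number \<open>M x\<close> is finite, so half of it can be
      absorbed on the left. The resulting bound no longer depends on x.\<close>
    also have "\<dots> \<le> M0 + 1 / 2 * M x"
      using K CW M_nonneg by (intro add_left_mono mult_right_mono) (auto simp: K_def field_simps)
    finally show ?thesis by simp
  qed
  obtain D where D: "D \<ge> 0" "\<forall>x A. finite A \<longrightarrow> (\<forall>e\<in>A. Re e \<le> x) \<longrightarrow>
             (\<Sum>e\<in>A. cmod (g e * qpow e \<tau>)) \<le> D * M x"
    using g unfolding dominated_def M_def by blast
  have "(\<Sum>e\<in>A. cmod (g e * qpow e \<tau>)) \<le> D * (2 * M0)" if "finite A" for A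
  proof -
    have "Re e \<le> Max (Re ` A)" if "e \<in> A" for e using that \<open>finite A\<close> by simp
    hence "(\<Sum>e\<in>A. cmod (g e * qpow e \<tau>)) \<le> D * M (Max (Re ` A))" using D(2) that by blast
    also have "\<dots> \<le> D * (2 * M0)" using D(1) bound by (intro mult_left_mono)
    finally show ?thesis .
  qed
  thus ?thesis
    unfolding gconv_norm by (intro nonneg_bdd_above_summable_on) (auto intro!: bdd_aboveI2)
qed

section \<open>Supports of formal series\<close>

lemma fser_ok_finite:
  assumes "fser_ok T f" "T > 0"
  shows "finite {e. f e \<noteq> 0 \<and> Re e \<le> x}"
proof -
  obtain \<Lambda> where \<Lambda>: "finite \<Lambda>" "\<And>e. f e \<noteq> 0 \<Longrightarrow> \<exists>lm\<in>\<Lambda>. \<exists>n::nat. e = lm + of_nat n / of_nat T"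
    using assms(1) unfolding fser_ok_def by blast
  show ?thesis
  proof (rule finite_subset)
    show "{e. f e \<noteq> 0 \<and> Re e \<le> x} \<subseteq> (\<Union>lm\<in>\<Lambda>. (\<lambda>n. lm + of_nat n / of_nat T) ` {..nat \<lceil>real T * (x - Re lm)\<rceil>})"
    proof clarify
      fix e assume e: "f e \<noteq> 0" "Re e \<le> x"
      from \<Lambda>(2)[OF e(1)] obtain lm and n :: nat
        where lm: "lm \<in> \<Lambda>" "e = lm + of_nat n / of_nat T" by blast
      have "real n / real T \<le> x - Re lm" using e(2) by (simp add: lm(2) Re_Im_of_nat_divide)
      hence "real n \<le> real T * (x - Re lm)" using assms(2) by (simp add: pos_divide_le_eq mult.commute)
      hence "n \<le> nat \<lceil>real T * (x - Re lm)\<rceil>" by linarith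
      thus "e \<in> (\<Union>lm\<in>\<Lambda>. (\<lambda>n. lm + of_nat n / of_nat T) ` {..nat \<lceil>real T * (x - Re lm)\<rceil>})"
        using lm by auto
    qed
  qed (use \<Lambda> in auto)
qed

lemma fser_ok_bounds:
  assumes "fser_ok T f"
  obtains c where "c \<ge> 0" "\<And>e. f e \<noteq> 0 \<Longrightarrow> Re e \<ge> - c \<and> \<bar>Im e\<bar> \<le> c"
proof -
  obtain \<Lambda> where \<Lambda>: "finite \<Lambda>" "\<And>e. f e \<noteq> 0 \<Longrightarrow> \<exists>lm\<in>\<Lambda>. \<exists>n::nat. e = lm + of_nat n / of_nat T"
    using assms(1) unfolding fser_ok_def by blast
  define c where "c = (\<Sum>lm\<in>\<Lambda>. cmod lm)"
  show ?thesis
  proof (rule that[of c])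
    show "c \<ge> 0" by (simp add: c_def sum_nonneg)
    fix e assume e: "f e \<noteq> 0"
    from \<Lambda>(2)[OF e] obtain lm and n :: nat
      where lm: "lm \<in> \<Lambda>" "e = lm + of_nat n / of_nat T" by blast
    have "Re e = Re lm + real n / real T \<and> Im e = Im lm"
      by (simp add: lm(2) Re_Im_of_nat_divide)
    moreover have "cmod lm \<le> c" unfolding c_def using lm \<Lambda>(1) by (intro member_le_sum) auto
    moreover have "\<bar>Re lm\<bar> \<le> cmod lm" "\<bar>Im lm\<bar> \<le> cmod lm"
      by (rule abs_Re_le_cmod abs_Im_le_cmod)+
    moreover have "real n / real T \<ge> 0" by simp
    ultimately show "Re e \<ge> - c \<and> \<bar>Im e\<bar> \<le> c" by linarith
  qed
qed

text \<open>The pair is determined by b, and Re a \<ge> 0 forces Re b \<le> Re e, which leaves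
  finitely many exponents of \<open>f\<close>.\<close>

lemma finite_gmul_index:
  assumes "nonneg_supp T E" "fser_ok T f" "T > 0"
  shows "finite {(a, b). a + b = e \<and> E a \<noteq> 0 \<and> f b \<noteq> 0}"
proof (rule finite_subset)
  show "{(a, b). a + b = e \<and> E a \<noteq> 0 \<and> f b \<noteq> 0} \<subseteq> (\<lambda>b. (e - b, b)) ` {b. f b \<noteq> 0 \<and> Re b \<le> Re e}"
  proof clarsimp
    fix a b assume ab: "e = a + b" "E a \<noteq> 0" "f b \<noteq> 0"
    have "Re a \<ge> 0" by (rule nonneg_suppD[OF assms(1) ab(2)])
    thus "(a, b) \<in> (\<lambda>ba. (a + b - ba, ba)) ` {ba. f ba \<noteq> 0 \<and> Re ba \<le> Re a + Re b}"
      using ab by (intro image_eqI[of _ _ b]) auto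
  qed
qed (use fser_ok_finite[OF assms(2,3)] in auto)

section \<open>Vertex operator superalgebras\<close>

text \<open>The series (e^z - 1)^(-n-1) e^(az) starts with z^(-n-1) and coefficient 1. Consequently
  v[n] is v(n) plus higher modes, and these produce lower weights.\<close>

lemma bcoef_diag: "bcoef n n a = 1"
proof -
  define F where "F = fps_to_fls (fps_exp 1) - (1 :: complex fls)"
  define G where "G = fps_to_fls (fps_exp a)"
  define k where "k = - n - 1"
  have F1: "fls_nth F 1 = 1" by (simp add: F_def)
  have sdF: "fls_subdegree F = 1"
  proof (rule fls_subdegree_eqI)
    fix i :: int assume "i < 1"
    thus "fls_nth F i = 0" by (cases "i = 0") (auto simp: F_def)
  qed (use F1 in simp)
  have F0: "F \<noteq> 0" using F1 by auto
  have sdG: "fls_subdegree G = 0"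
    by (simp add: G_def fls_subdegree_fls_to_fps)
  have G0: "fls_nth G 0 = 1" by (simp add: G_def)
  hence G_nz: "G \<noteq> 0" by auto
  have sdFp: "fls_subdegree (F ^ m) = int m" for m
    by (simp add: fls_subdegree_pow sdF)
  have Fp: "fls_nth (F ^ m) (int m) = 1" for m
  proof (induction m)
    case (Suc m)
    have "fls_nth (F * F ^ m) (fls_subdegree F + fls_subdegree (F ^ m)) = 1"
      unfolding fls_times_base using Suc F1 by (simp add: sdF sdFp)
    thus ?case by (simp add: sdF sdFp)
  qed simp
  have "fls_nth (F powi k * G) k = 1"
  proof (cases "k \<ge> 0")
    case True
    then obtain m where m: "k = int m" using nonneg_int_cases by blast
    have "fls_nth (F ^ m * G) (fls_subdegree (F ^ m) + fls_subdegree G) = 1"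
      unfolding fls_times_base by (simp add: sdG G0 sdFp Fp)
    thus ?thesis by (simp add: m sdFp sdG)
  next
    case False
    then obtain m where m: "k = - int m" by (metis int_cases4 less_eq_int_code(1) neg_0_le_iff_le of_nat_0_le_iff)
    let ?h = "F powi k * G"
    have sdh: "fls_subdegree ?h = k"
      using F0 G_nz by (simp add: sdF sdG)
    \<comment> \<open>Leading coefficients multiply, so the one of a negative power is read off from
      this product instead of from an expansion of the inverse.\<close>
    have "F ^ m * ?h = G" using F0 by (simp add: m power_int_minus field_simps)
    moreover have "fls_subdegree (F ^ m) + fls_subdegree ?h = 0"
      unfolding sdFp sdh by (simp add: m)
    ultimately have "fls_nth (F ^ m * ?h) (fls_subdegree (F ^ m) + fls_subdegree ?h) = 1"
      by (simp only: G0)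
    thus ?thesis unfolding fls_times_base unfolding sdh sdFp Fp by simp
  qed
  thus ?thesis by (simp add: bcoef_def F_def G_def k_def)
qed

lemma fsum_eq_sum:
  assumes "finite A" "\<And>k. k \<notin> A \<Longrightarrow> f k = 0"
  shows "fsum f = sum f A"
  unfolding fsum_def using assms by (intro sum.mono_neutral_left) auto

locale vertex_superalgebra =
  fixes V :: "('v::ab_group_add) vosa"
  assumes is_vosa: "is_vosa V"
begin

sublocale vector_space "scl V"
  using is_vosa unfolding is_vosa_def by (elim conjE)

lemma subspace_wsp: "subspace (wsp V r)"
  using is_vosa unfolding is_vosa_def by (elim conjE) (erule allE)

lemma wsp_nonhalf: "2 * r \<notin> \<int> \<Longrightarrow> wsp V r = {0}"
  using is_vosa unfolding is_vosa_def by (elim conjE) blast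

lemma ex_wdecomp: "\<exists>!c. is_wdecomp V v c"
  using is_vosa unfolding is_vosa_def by (elim conjE) (erule allE)

lemma Y_add_left: "Y V (u + u') n w = Y V u n w + Y V u' n w"
  and Y_scale_left: "Y V (scl V a u) n w = scl V a (Y V u n w)"
  and Y_add_right: "Y V u n (w + w') = Y V u n w + Y V u n w'"
  and Y_scale_right: "Y V u n (scl V a w) = scl V a (Y V u n w)"
  using is_vosa unfolding is_vosa_def by simp_all

lemma truncation: "\<exists>N. \<forall>n\<ge>N. Y V u n w = 0"
  using is_vosa unfolding is_vosa_def by simp

lemma Y_vac: "Y V (vac V) n w = (if n = -1 then w else 0)"
  using is_vosa unfolding is_vosa_def by simp

lemma vac_wsp: "vac V \<in> wsp V 0" and om_wsp: "om V \<in> wsp V 2"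
  using is_vosa unfolding is_vosa_def by simp_all

lemma L0_wsp: "v \<in> wsp V r \<Longrightarrow> Y V (om V) 1 v = scl V (of_real r) v"
  using is_vosa unfolding is_vosa_def by simp

lemma translation: "Y V (Y V (om V) 0 u) n w = scl V (- of_int n) (Y V u (n - 1) w)"
  using is_vosa unfolding is_vosa_def by simp

lemma jacobi:
  assumes "par_hom V p u" "par_hom V p' v"
  shows "fsum (\<lambda>i::nat. scl V ((of_int m) gchoose i) (Y V (Y V u (l + int i) v) (m + n - int i) w))
      = fsum (\<lambda>i::nat. scl V ((-1)^i * ((of_int l) gchoose i))
            (Y V u (m + l - int i) (Y V v (n + int i) w)
             - scl V ((-1) powi l * sgn_par (p \<and> p')) (Y V v (n + l - int i) (Y V u (m + int i) w))))"
proof -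
  have "\<forall>p p' u v w m n l. par_hom V p u \<longrightarrow> par_hom V p' v \<longrightarrow>
        fsum (\<lambda>i::nat. scl V ((of_int m) gchoose i) (Y V (Y V u (l + int i) v) (m + n - int i) w))
      = fsum (\<lambda>i::nat. scl V ((-1)^i * ((of_int l) gchoose i))
            (Y V u (m + l - int i) (Y V v (n + int i) w)
             - scl V ((-1) powi l * sgn_par (p \<and> p')) (Y V v (n + l - int i) (Y V u (m + int i) w))))"
    using is_vosa unfolding is_vosa_def by (elim conjE)
  from this[rule_format, OF assms] show ?thesis .
qed

lemma Y_0_left [simp]: "Y V 0 n w = 0"
  using Y_scale_left[of 0 0 n w] by simp

lemma Y_0_right [simp]: "Y V u n 0 = 0"
  using Y_scale_right[of u n 0 0] by simp

lemma subspace_vimage_Y_left: "subspace U \<Longrightarrow> subspace {u. Y V u n w \<in> U}"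
  unfolding subspace_def by (auto simp: Y_add_left Y_scale_left)

lemma subspace_vimage_Y_right: "subspace U \<Longrightarrow> subspace {w. Y V u n w \<in> U}"
  unfolding subspace_def by (auto simp: Y_add_right Y_scale_right)

subsection \<open>Weight components\<close>

lemma is_wdecomp_wcomp: "is_wdecomp V v (wcomp V v)"
  using theI'[OF ex_wdecomp[of v]] by (simp add: wcomp_def)

lemma wcomp_eqI:
  assumes "finite R" "\<And>r. r \<notin> R \<Longrightarrow> c r = 0" "\<And>r. c r \<in> wsp V r" "v = (\<Sum>r\<in>R. c r)"
  shows "wcomp V v = c"
proof -
  have "{r. c r \<noteq> 0} \<subseteq> R" using assms(2) by auto
  hence "is_wdecomp V v c"
    unfolding is_wdecomp_def using assms finite_subset
    by (auto intro!: sum.mono_neutral_right)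
  thus ?thesis using ex_wdecomp is_wdecomp_wcomp by blast
qed

lemma finite_wcomp: "finite {r. wcomp V v r \<noteq> 0}"
  and wcomp_wsp: "wcomp V v r \<in> wsp V r"
  and wcomp_sum: "v = (\<Sum>r\<in>{r. wcomp V v r \<noteq> 0}. wcomp V v r)"
  using is_wdecomp_wcomp[of v] by (auto simp: is_wdecomp_def)

lemma wcomp_sum_superset:
  assumes "finite R" "{r. wcomp V v r \<noteq> 0} \<subseteq> R"
  shows "v = (\<Sum>r\<in>R. wcomp V v r)"
  using assms by (subst wcomp_sum) (auto intro: sum.mono_neutral_left)

lemma wcomp_add: "wcomp V (u + v) r = wcomp V u r + wcomp V v r"
proof -
  let ?R = "{r. wcomp V u r \<noteq> 0} \<union> {r. wcomp V v r \<noteq> 0}"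
  have "wcomp V (u + v) = (\<lambda>r. wcomp V u r + wcomp V v r)"
  proof (rule wcomp_eqI[of ?R])
    show "u + v = (\<Sum>r\<in>?R. wcomp V u r + wcomp V v r)"
      unfolding sum.distrib using wcomp_sum_superset[of ?R u] wcomp_sum_superset[of ?R v]
      by (simp add: finite_wcomp)
  qed (auto simp: finite_wcomp intro: subspace_add subspace_wsp wcomp_wsp)
  thus ?thesis by simp
qed

lemma wcomp_scale: "wcomp V (scl V a u) r = scl V a (wcomp V u r)"
proof -
  have "wcomp V (scl V a u) = (\<lambda>r. scl V a (wcomp V u r))"
  proof (rule wcomp_eqI[OF finite_wcomp[of u]])
    show "scl V a u = (\<Sum>r\<in>{r. wcomp V u r \<noteq> 0}. scl V a (wcomp V u r))"
      using wcomp_sum[of u] by (metis scale_sum_right)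
  qed (auto intro: subspace_scale subspace_wsp wcomp_wsp)
  thus ?thesis by simp
qed

lemma wcomp_wsp_eq: "v \<in> wsp V r \<Longrightarrow> wcomp V v = (\<lambda>s. if s = r then v else 0)"
  by (rule wcomp_eqI[of "{r}"]) (auto intro: subspace_0 subspace_wsp)

lemma weight_space_induct:
  assumes "subspace U" "\<And>r v. v \<in> wsp V r \<Longrightarrow> v \<in> U"
  shows "v \<in> U"
  by (subst wcomp_sum) (intro subspace_sum assms(1) assms(2)[OF wcomp_wsp])

text \<open>L(0) multiplies the component of weight r by r, so an eigenvector has no component of
  another weight. The axioms say that weight vectors are eigenvectors; this converse is what shows
  that modes and automorphisms respect the grading.\<close>

lemma L0_eigenvector_wsp:
  assumes "Y V (om V) 1 x = scl V (of_real c) x"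
  shows "x \<in> wsp V c"
proof -
  let ?R = "{r. wcomp V x r \<noteq> 0}"
  have "subspace {v. wcomp V (Y V (om V) 1 v) = (\<lambda>r. scl V (of_real r) (wcomp V v r))}"
    unfolding subspace_def
    by (auto simp: Y_add_right Y_scale_right wcomp_add wcomp_scale fun_eq_iff scale_right_distrib
        scale_left_commute wcomp_wsp_eq[OF subspace_0[OF subspace_wsp[of 0]]])
  hence "x \<in> {v. wcomp V (Y V (om V) 1 v) = (\<lambda>r. scl V (of_real r) (wcomp V v r))}"
  proof (rule weight_space_induct)
    fix r v assume v: "v \<in> wsp V r"
    thus "v \<in> {v. wcomp V (Y V (om V) 1 v) = (\<lambda>r. scl V (of_real r) (wcomp V v r))}"
      by (auto simp: L0_wsp wcomp_scale wcomp_wsp_eq)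
  qed
  hence "scl V (of_real r) (wcomp V x r) = scl V (of_real c) (wcomp V x r)" for r
    unfolding mem_Collect_eq assms fun_eq_iff wcomp_scale by metis
  hence "wcomp V x r = 0" if "r \<noteq> c" for r
    using that \<open>scl V (of_real r) (wcomp V x r) = scl V (of_real c) (wcomp V x r)\<close>
    unfolding scale_cancel_right by simp
  hence "x = wcomp V x c" using wcomp_sum_superset[of "{c}" x] by auto
  thus ?thesis using wcomp_wsp by metis
qed

lemma half_weight_cases:
  assumes "v \<in> wsp V r" "v \<noteq> 0"
  shows "r \<in> \<int> \<or> r - 1/2 \<in> \<int>"
proof -
  have "2 * r \<in> \<int>" using assms wsp_nonhalf by fastforce
  then obtain z where z: "2 * r = of_int z" by (auto elim: Ints_cases)
  show ?thesis
  proof (cases "even z")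
    case True
    then obtain y where "z = 2 * y" by blast
    hence "r = of_int y" using z by simp
    thus ?thesis by simp
  next
    case False
    then obtain y where "z = 2 * y + 1" by (elim oddE)
    hence "r - 1/2 = of_int y" using z by simp
    thus ?thesis by (metis Ints_of_int)
  qed
qed

lemma par_hom_wsp: "v \<in> wsp V r \<Longrightarrow> (if p then r - 1/2 \<in> \<int> else r \<in> \<int>) \<Longrightarrow> par_hom V p v"
  by (auto simp: par_hom_def wcomp_wsp_eq)

lemma ex_par_hom_wsp:
  assumes "v \<in> wsp V r"
  shows "\<exists>p. par_hom V p v"
proof (cases "v = 0")
  case True
  thus ?thesis using wcomp_wsp_eq[OF assms] by (auto simp: par_hom_def)
next
  case False
  thus ?thesis using half_weight_cases[OF assms] par_hom_wsp[OF assms, of True] par_hom_wsp[OF assms, of False]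
    by auto
qed

text \<open>The Borcherds identity with m = 1, l = 0 and the conformal vector is the commutator
  [L(0), u(n)] = (L(-1)u)(n+1) + (L(0)u)(n); by translation its right side is (a - n - 1)
  u(n).\<close>

lemma Y_wsp:
  assumes u: "u \<in> wsp V a" and v: "v \<in> wsp V b"
  shows "Y V u n v \<in> wsp V (a + b - of_int n - 1)"
proof (rule L0_eigenvector_wsp)
  obtain p where p: "par_hom V p u" using ex_par_hom_wsp[OF u] by blast
  have om: "par_hom V False (om V)" by (rule par_hom_wsp[OF om_wsp]) simp
  have "fsum (\<lambda>i::nat. scl V ((of_int 1) gchoose i) (Y V (Y V (om V) (0 + int i) u) (1 + n - int i) v))
      = (\<Sum>i\<in>{0, 1::nat}. scl V ((of_int 1) gchoose i) (Y V (Y V (om V) (0 + int i) u) (1 + n - int i) v))"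
  proof (rule fsum_eq_sum)
    fix i :: nat assume "i \<notin> {0, 1}"
    hence "(of_int 1 :: complex) gchoose i = 0"
      using binomial_gbinomial[of 1 i, where 'a = complex] by (simp add: binomial_eq_0)
    thus "scl V ((of_int 1) gchoose i) (Y V (Y V (om V) (0 + int i) u) (1 + n - int i) v) = 0"
      by simp
  qed simp
  also have "\<dots> = Y V (Y V (om V) 0 u) (1 + n) v + Y V (Y V (om V) 1 u) n v"
    by simp
  also have "\<dots> = scl V (of_real a - of_int n - 1) (Y V u n v)"
    by (simp add: translation L0_wsp[OF u] Y_scale_left algebra_simps flip: scale_left_distrib scale_left_diff_distrib)
  finally have 1: "fsum (\<lambda>i::nat. scl V ((of_int 1) gchoose i) (Y V (Y V (om V) (0 + int i) u) (1 + n - int i) v))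
      = scl V (of_real a - of_int n - 1) (Y V u n v)" .
  have "fsum (\<lambda>i::nat. scl V ((-1)^i * ((of_int 0) gchoose i))
            (Y V (om V) (1 + 0 - int i) (Y V u (n + int i) v)
             - scl V ((-1) powi 0 * sgn_par (False \<and> p)) (Y V u (n + 0 - int i) (Y V (om V) (1 + int i) v))))
     = (\<Sum>i\<in>{0::nat}. scl V ((-1)^i * ((of_int 0) gchoose i))
            (Y V (om V) (1 + 0 - int i) (Y V u (n + int i) v)
             - scl V ((-1) powi 0 * sgn_par (False \<and> p)) (Y V u (n + 0 - int i) (Y V (om V) (1 + int i) v))))"
    by (rule fsum_eq_sum) (auto simp: gbinomial_0_left)
  also have "\<dots> = Y V (om V) 1 (Y V u n v) - scl V (of_real b) (Y V u n v)"
    by (simp add: sgn_par_def L0_wsp[OF v] Y_scale_right)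
  finally have "scl V (of_real a - of_int n - 1) (Y V u n v)
      = Y V (om V) 1 (Y V u n v) - scl V (of_real b) (Y V u n v)"
    using jacobi[OF om p, of 1 0 n v] 1 by simp
  hence "Y V (om V) 1 (Y V u n v) = scl V (of_real a - of_int n - 1) (Y V u n v) + scl V (of_real b) (Y V u n v)"
    by (simp add: algebra_simps)
  also have "\<dots> = scl V (of_real (a + b - of_int n - 1)) (Y V u n v)"
    by (simp add: algebra_simps flip: scale_left_distrib)
  finally show "Y V (om V) 1 (Y V u n v) = scl V (of_real (a + b - of_int n - 1)) (Y V u n v)" .
qed

text \<open>Weights are real but bounded below, and every appeal to the induction hypothesis
  descends by at least 1, so induction on the number of unit steps above the lower bound
  suffices.\<close>

lemma weight_induct [consumes 1, case_names zero step]: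
  assumes "v \<in> wsp V r" and zero: "\<And>r. P r 0"
    and step: "\<And>r v. (\<And>s x. s \<le> r - 1 \<Longrightarrow> x \<in> wsp V s \<Longrightarrow> P s x) \<Longrightarrow> v \<in> wsp V r \<Longrightarrow> P r v"
  shows "P r v"
proof -
  obtain r0 where r0: "\<And>r. r < r0 \<Longrightarrow> wsp V r = {0}"
    using is_vosa unfolding is_vosa_def by (elim conjE) blast
  have "\<forall>r < r0 + real n. \<forall>v\<in>wsp V r. P r v" for n
  proof (induction n)
    case 0
    thus ?case using r0 zero by auto
  next
    case (Suc n)
    show ?case
    proof (intro allI impI ballI)
      fix r v assume r: "r < r0 + real (Suc n)" and v: "v \<in> wsp V r"
      show "P r v"
      proof (rule step[OF _ v])
        fix s x assume "s \<le> r - 1" "x \<in> wsp V s"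
        moreover from this r have "s < r0 + real n" by simp
        ultimately show "P s x" using Suc.IH by blast
      qed
    qed
  qed
  moreover obtain n where "r - r0 < real n" using reals_Archimedean2 by blast
  moreover from this have "r < r0 + real n" by simp
  ultimately show ?thesis using assms(1) by blast
qed

text \<open>Between the lower bound for the weights and R lie finitely many half-integers, each with
  a finite-dimensional weight space.\<close>

lemma ex_finite_generators:
  "\<exists>W. finite W \<and> (\<forall>r\<le>R. wsp V r \<subseteq> span W)"
proof -
  obtain r0 where r0: "\<And>r. r < r0 \<Longrightarrow> wsp V r = {0}"
    using is_vosa unfolding is_vosa_def by (elim conjE) blast
  have "\<forall>r. \<exists>B. finite B \<and> B \<subseteq> wsp V r \<and> span B = wsp V r"
    using is_vosa unfolding is_vosa_def by (elim conjE)
  then obtain B where B: "\<And>r. finite (B r)" "\<And>r. span (B r) = wsp V r" by metis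
  define I where "I = {r. 2 * r \<in> \<int> \<and> r0 \<le> r \<and> r \<le> R}"
  have "I \<subseteq> (\<lambda>z. of_int z / 2) ` {\<lfloor>2 * r0\<rfloor>..\<lceil>2 * R\<rceil>}"
  proof
    fix r assume r: "r \<in> I"
    then obtain z where "2 * r = of_int z" by (auto simp: I_def elim: Ints_cases)
    hence "r = of_int z / 2" by simp
    moreover have "z \<in> {\<lfloor>2 * r0\<rfloor>..\<lceil>2 * R\<rceil>}" using r \<open>r = of_int z / 2\<close> by (auto simp: I_def) linarith+
    ultimately show "r \<in> (\<lambda>z. of_int z / 2) ` {\<lfloor>2 * r0\<rfloor>..\<lceil>2 * R\<rceil>}" by blast
  qed
  hence I: "finite I" by (rule finite_subset) auto
  show ?thesis
  proof (intro exI[of _ "\<Union>r\<in>I. B r"] conjI allI impI)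
    show "finite (\<Union>r\<in>I. B r)" using I B by auto
    fix r assume r: "r \<le> R"
    show "wsp V r \<subseteq> span (\<Union>r\<in>I. B r)"
    proof (cases "r \<in> I")
      case True
      thus ?thesis using B(2)[of r] span_mono[of "B r" "\<Union>r\<in>I. B r"] by auto
    next
      case False
      hence "wsp V r = {0}" using r r0 wsp_nonhalf by (force simp: I_def)
      thus ?thesis by (simp add: span_zero)
    qed
  qed
qed

subsection \<open>The square-bracket modes\<close>

text \<open>Summing over a fixed interval instead of over the nonvanishing modes makes the
  expression linear in w.\<close>

lemma brk_hom:
  assumes "u \<in> wsp V a" "\<forall>m>N. Y V u m w = 0"
  shows "brk V u n w = (\<Sum>m\<in>{n..N}. scl V (bcoef m n (of_real a)) (Y V u m w))"
proof -
  have "brk V u n w = (\<Sum>m\<in>{m. n \<le> m \<and> Y V u m w \<noteq> 0}. scl V (bcoef m n (of_real a)) (Y V u m w))"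
  proof (cases "u = 0")
    case True
    thus ?thesis using wcomp_wsp_eq[OF assms(1)] by (simp add: brk_def)
  next
    case False
    hence "{r. wcomp V u r \<noteq> 0} = {a}" by (auto simp: wcomp_wsp_eq[OF assms(1)])
    thus ?thesis by (simp add: brk_def wcomp_wsp_eq[OF assms(1)])
  qed
  also have "\<dots> = (\<Sum>m\<in>{n..N}. scl V (bcoef m n (of_real a)) (Y V u m w))"
    using assms(2) by (intro sum.mono_neutral_left) (auto simp: not_less[symmetric])
  finally show ?thesis .
qed

lemma brk_0_left: "brk V 0 n w = 0"
  using brk_hom[OF subspace_0[OF subspace_wsp[of 0]], of 0 w n] by simp

lemma brk_eq_sum_wcomp:
  assumes "finite R" "{r. wcomp V v r \<noteq> 0} \<subseteq> R"
  shows "brk V v n w = (\<Sum>r\<in>R. brk V (wcomp V v r) n w)"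
proof -
  have *: "brk V (wcomp V v r) n w = (\<Sum>m\<in>{m. n \<le> m \<and> Y V (wcomp V v r) m w \<noteq> 0}.
         scl V (bcoef m n (complex_of_real r)) (Y V (wcomp V v r) m w))" for r
  proof (cases "wcomp V v r = 0")
    case True
    thus ?thesis using wcomp_wsp_eq[of 0 0] by (simp add: brk_def subspace_0 subspace_wsp)
  next
    case False
    hence "{s. wcomp V (wcomp V v r) s \<noteq> 0} = {r}" by (auto simp: wcomp_wsp_eq[OF wcomp_wsp])
    thus ?thesis by (simp add: brk_def wcomp_wsp_eq[OF wcomp_wsp])
  qed
  have "brk V v n w = (\<Sum>r\<in>{r. wcomp V v r \<noteq> 0}. brk V (wcomp V v r) n w)"
    by (subst brk_def) (simp only: *)
  also have "\<dots> = (\<Sum>r\<in>R. brk V (wcomp V v r) n w)"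
    using assms by (intro sum.mono_neutral_left) (auto simp: brk_0_left)
  finally show ?thesis .
qed

lemma truncation_gt: "\<exists>N. \<forall>M\<ge>N. \<forall>m>M. Y V u m w = 0"
  using truncation[of u w] by (meson less_imp_le order_trans)

lemma brk_truncation: "\<exists>N. \<forall>n\<ge>N. brk V v n w = 0"
proof -
  have "\<exists>N. \<forall>n\<ge>N. \<forall>r. r \<in> R \<longrightarrow> brk V (wcomp V v r) n w = 0" if "finite R" for R
    using that
  proof (induction R)
    case (insert r R)
    then obtain N where N: "\<forall>n\<ge>N. \<forall>r. r \<in> R \<longrightarrow> brk V (wcomp V v r) n w = 0" by blast
    obtain N' where N': "\<And>M. M \<ge> N' \<Longrightarrow> \<forall>m>M. Y V (wcomp V v r) m w = 0" using truncation_gt by blast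
    have "brk V (wcomp V v r) n w = 0" if "n > N'" for n
      by (subst brk_hom[OF wcomp_wsp N'[OF order_refl]]) (use that in simp)
    thus ?case using N by (intro exI[of _ "max N (N' + 1)"]) auto
  qed auto
  from this[OF finite_wcomp[of v]] show ?thesis
    using brk_eq_sum_wcomp[OF finite_wcomp[of v] order_refl, of _ w] by (auto intro!: sum.neutral)
qed

text \<open>Only modes u(m) with m \<ge> n enter u[n], and raising m lowers the weight of
  u(m)w.\<close>

lemma brk_lower_weight:
  assumes u: "u \<in> wsp V a" and w: "w \<in> wsp V b" and U: "subspace U"
    and lower: "\<And>s v. s \<le> a + b - of_int n - 1 \<Longrightarrow> v \<in> wsp V s \<Longrightarrow> v \<in> U"
  shows "brk V u n w \<in> U"
proof -
  obtain N where N: "\<forall>m>N. Y V u m w = 0" using truncation_gt by blast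
  show ?thesis
    unfolding brk_hom[OF u N, where n = n]
    by (intro subspace_sum[OF U] subspace_scale[OF U] lower[OF _ Y_wsp[OF u w]]) auto
qed

lemma Y_minus_brk:
  assumes u: "u \<in> wsp V a" and U: "subspace U" and lower: "\<And>m. m > n \<Longrightarrow> Y V u m w \<in> U"
  shows "Y V u n w - brk V u n w \<in> U"
proof -
  obtain N' where "\<forall>M\<ge>N'. \<forall>m>M. Y V u m w = 0" using truncation_gt by blast
  then obtain N where N: "\<forall>m>N. Y V u m w = 0" "N \<ge> n"
    by (metis max.cobounded1 max.cobounded2)
  have "brk V u n w = Y V u n w + (\<Sum>m\<in>{n+1..N}. scl V (bcoef m n (of_real a)) (Y V u m w))"
  proof -
    have "{n..N} = insert n {n+1..N}" using N(2) by auto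
    thus ?thesis unfolding brk_hom[OF u N(1), where n = n] by (simp add: bcoef_diag)
  qed
  moreover have "(\<Sum>m\<in>{n+1..N}. scl V (bcoef m n (of_real a)) (Y V u m w)) \<in> U"
    by (intro subspace_sum[OF U] subspace_scale[OF U] lower) auto
  ultimately show ?thesis using subspace_neg[OF U] by fastforce
qed

lemma Y_minus_brk_lower_weight:
  assumes u: "u \<in> wsp V a" and w: "w \<in> wsp V b" and U: "subspace U"
    and lower: "\<And>s v. s \<le> a + b - of_int n - 2 \<Longrightarrow> v \<in> wsp V s \<Longrightarrow> v \<in> U"
  shows "Y V u n w - brk V u n w \<in> U"
proof (rule Y_minus_brk[OF u U])
  fix m :: int assume "m > n"
  hence "real_of_int m \<ge> real_of_int n + 1" by linarith
  thus "Y V u m w \<in> U" by (intro lower[OF _ Y_wsp[OF u w]]) simp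
qed

text \<open>The vacuum part of \<omega> - c/24 acts through its mode -1 alone, hence as a scalar,
  and only for n \<le> -2. In particular L[0] is the bracket mode 1 of the conformal vector.\<close>

lemma Lbr_eq:
  "Lbr V n v = brk V (om V) (n + 1) v - scl V (if n \<le> -2 then cc V / 24 * bcoef (-1) (n + 1) 0 else 0) v"
proof -
  define c where "c = scl V (- (cc V / 24)) (vac V)"
  have c: "c \<in> wsp V 0" unfolding c_def by (intro subspace_scale subspace_wsp vac_wsp)
  have wc: "wcomp V (om V - scl V (cc V / 24) (vac V)) = (\<lambda>r. if r = 2 then om V else if r = 0 then c else 0)"
    by (rule wcomp_eqI[of "{0, 2}"]) (auto simp: c om_wsp subspace_0 subspace_wsp, simp add: c_def)
  have sub: "{r. (if r = 2 then om V else if r = 0 then c else 0) \<noteq> 0} \<subseteq> {0, 2 :: real}"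
    by auto
  have "Lbr V n v = (\<Sum>r\<in>{0, 2::real}. brk V (if r = 2 then om V else if r = 0 then c else 0) (n + 1) v)"
    unfolding Lbr_def using brk_eq_sum_wcomp[of "{0, 2}" "om V - scl V (cc V / 24) (vac V)" "n + 1" v]
    unfolding wc using sub by blast
  also have "\<dots> = brk V (om V) (n + 1) v + brk V c (n + 1) v" by simp
  also have "brk V c (n + 1) v = (\<Sum>m\<in>{n+1..-1}. scl V (bcoef m (n+1) (of_real 0)) (Y V c m v))"
    by (rule brk_hom[OF c]) (simp add: c_def Y_scale_left Y_vac del: scale_minus_left)
  also have "\<dots> = (\<Sum>m\<in>{n+1..-1}. if m = -1 then - scl V (cc V / 24 * bcoef (-1) (n + 1) 0) v else 0)"
    unfolding c_def Y_scale_left Y_vac by (intro sum.cong) (auto simp: mult.commute)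
  also have "\<dots> = - scl V (if n \<le> -2 then cc V / 24 * bcoef (-1) (n + 1) 0 else 0) v"
    by (simp add: sum.delta)
  finally show ?thesis by simp
qed

lemma brk_hom_add:
  assumes "u \<in> wsp V a"
  shows "brk V u n (v + w) = brk V u n v + brk V u n w"
proof -
  obtain N1 N2 where "\<forall>M\<ge>N1. \<forall>m>M. Y V u m v = 0" "\<forall>M\<ge>N2. \<forall>m>M. Y V u m w = 0"
    using truncation_gt by metis
  then obtain N where N: "\<forall>m>N. Y V u m v = 0" "\<forall>m>N. Y V u m w = 0"
    by (metis max.cobounded1 max.cobounded2)
  have "\<forall>m>N. Y V u m (v + w) = 0" using N by (simp add: Y_add_right)
  from brk_hom[OF assms this, where n = n] show ?thesis
    unfolding brk_hom[OF assms N(1), where n = n] brk_hom[OF assms N(2), where n = n]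
    by (simp add: Y_add_right scale_right_distrib sum.distrib)
qed

lemma brk_hom_scale:
  assumes "u \<in> wsp V a"
  shows "brk V u n (scl V c v) = scl V c (brk V u n v)"
proof -
  obtain N where N: "\<forall>m>N. Y V u m v = 0" using truncation_gt by blast
  have "\<forall>m>N. Y V u m (scl V c v) = 0" using N by (simp add: Y_scale_right)
  from brk_hom[OF assms this, where n = n] show ?thesis
    unfolding brk_hom[OF assms N, where n = n]
    by (simp add: Y_scale_right scale_sum_right mult.commute)
qed

lemma Lbr_add: "Lbr V n (v + w) = Lbr V n v + Lbr V n w"
  by (simp add: Lbr_eq brk_hom_add[OF om_wsp] scale_right_distrib)

lemma Lbr_scale: "Lbr V n (scl V c v) = scl V c (Lbr V n v)"
  by (simp add: Lbr_eq brk_hom_scale[OF om_wsp] scale_right_diff_distrib scale_left_commute mult.commute)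

lemma Lbr_truncation: "\<exists>N. \<forall>n\<ge>N. Lbr V n v = 0"
proof -
  obtain N where N: "\<forall>n\<ge>N. brk V (om V - scl V (cc V / 24) (vac V)) n v = 0"
    using brk_truncation by blast
  show ?thesis
    unfolding Lbr_def using N by (intro exI[of _ N]) auto
qed

subsection \<open>Automorphisms of finite order\<close>

lemma aut_add: "vosa_aut V g \<Longrightarrow> g (u + v) = g u + g v"
  and aut_scale: "vosa_aut V g \<Longrightarrow> g (scl V a v) = scl V a (g v)"
  and aut_Y: "vosa_aut V g \<Longrightarrow> g (Y V u n v) = Y V (g u) n (g v)"
  and aut_om: "vosa_aut V g \<Longrightarrow> g (om V) = om V"
  by (simp_all add: vosa_aut_def)

lemma aut_sum: "vosa_aut V g \<Longrightarrow> g (\<Sum>i\<in>I. f i) = (\<Sum>i\<in>I. g (f i))"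
proof (induction I rule: infinite_finite_induct)
  case empty
  thus ?case using aut_scale[of g 0 0] by simp
next
  case (infinite A)
  thus ?case using aut_scale[of g 0 0] by simp
qed (simp add: aut_add)

lemma aut_wsp: "vosa_aut V g \<Longrightarrow> v \<in> wsp V r \<Longrightarrow> g v \<in> wsp V r"
  by (intro L0_eigenvector_wsp) (metis L0_wsp aut_Y aut_om aut_scale)

text \<open>The discrete Fourier projection onto an eigenspace of an operator of order n. The
  eigenvalue is exp(-2 pi i j/n), matching the convention that g acts on v by the inverse of
  mu.\<close>

definition eigproj :: "('v \<Rightarrow> 'v) \<Rightarrow> nat \<Rightarrow> nat \<Rightarrow> 'v \<Rightarrow> 'v" where
  "eigproj g n j v = scl V (1 / of_nat n)
     (\<Sum>k<n. scl V (exp (2 * pi * \<i> * of_nat j / of_nat n) ^ k) ((g ^^ k) v))"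

lemma sum_roots_of_unity:
  assumes "k < n"
  shows "(\<Sum>j<n. exp (2 * pi * \<i> * of_nat j / of_nat n) ^ k) = (if k = 0 then of_nat n else (0::complex))"
proof (cases "k = 0")
  case False
  define z where "z = exp (2 * pi * \<i> * of_nat k / of_nat n)"
  have "exp (2 * pi * \<i> * of_nat j / of_nat n) ^ k = z ^ j" for j
    unfolding z_def exp_of_nat_mult[symmetric] by (simp add: mult_ac)
  moreover have "z ^ n = 1" unfolding z_def using assms complex_root_unity[of n k] by simp
  moreover have "z \<noteq> 1"
    unfolding z_def using assms False complex_root_unity_eq_1[of n k] by (auto dest: dvd_imp_le)
  ultimately show ?thesis using False by (simp add: sum_gp_strict)
qed simp

lemma eigproj_sum:
  assumes "n > 0"
  shows "(\<Sum>j<n. eigproj g n j v) = v"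
proof -
  have "(\<Sum>j<n. eigproj g n j v) = scl V (1 / of_nat n)
      (\<Sum>k<n. scl V (\<Sum>j<n. exp (2 * pi * \<i> * of_nat j / of_nat n) ^ k) ((g ^^ k) v))"
    unfolding eigproj_def scale_sum_right[symmetric] scale_sum_left
    by (subst sum.swap) (rule refl)
  also have "(\<Sum>k<n. scl V (\<Sum>j<n. exp (2 * pi * \<i> * of_nat j / of_nat n) ^ k) ((g ^^ k) v))
      = (\<Sum>k<n. if k = 0 then scl V (of_nat n) v else 0)"
    by (intro sum.cong) (simp_all add: sum_roots_of_unity del: of_real_mult)
  also have "scl V (1 / of_nat n) \<dots> = v" using assms by (simp add: sum.delta)
  finally show ?thesis .
qed

lemma eigproj_eigen:
  assumes g: "vosa_aut V g" "g ^^ n = id" and n: "n > 0"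
  shows "g (eigproj g n j v) = scl V (inverse (exp (2 * pi * \<i> * of_nat j / of_nat n))) (eigproj g n j v)"
proof -
  define z where "z = exp (2 * pi * \<i> * of_nat j / of_nat n)"
  have zn: "z ^ n = 1" unfolding z_def using n complex_root_unity[of n j] by simp
  define F where "F k = scl V (z ^ k) ((g ^^ k) v)" for k
  have "sum F {..<n} + F n = F 0 + (\<Sum>k<n. F (Suc k))"
    by (metis sum.lessThan_Suc sum.lessThan_Suc_shift)
  moreover have "F n = F 0" by (simp add: F_def zn g)
  ultimately have shift: "(\<Sum>k<n. F (Suc k)) = sum F {..<n}" by simp
  have "g (eigproj g n j v) = scl V (1 / of_nat n) (\<Sum>k<n. scl V (z ^ k) ((g ^^ Suc k) v))"
    by (simp add: eigproj_def aut_scale[OF g(1)] aut_sum[OF g(1)] z_def)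
  also have "(\<Sum>k<n. scl V (z ^ k) ((g ^^ Suc k) v)) = scl V (inverse z) (\<Sum>k<n. F (Suc k))"
    unfolding scale_sum_right by (intro sum.cong) (simp_all add: F_def z_def)
  also have "scl V (1 / of_nat n) \<dots> = scl V (inverse z) (eigproj g n j v)"
    unfolding shift by (simp add: eigproj_def F_def z_def mult.commute)
  finally show ?thesis by (simp add: z_def)
qed

lemma eigproj_mem:
  assumes "subspace U" "v \<in> U" "\<And>x. x \<in> U \<Longrightarrow> g x \<in> U"
  shows "eigproj g n j v \<in> U"
proof -
  have "(g ^^ k) v \<in> U" for k by (induction k) (use assms in auto)
  thus ?thesis unfolding eigproj_def by (intro subspace_scale subspace_sum assms(1))
qed

text \<open>Commuting operators of finite order are simultaneously diagonalisable, here inside one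
  weight space: v is projected by \<open>g\<close> and then by \<open>h\<close>, and the second
  projection stays in the eigenspace of the first because the two commute.\<close>

lemma joint_eigenvector_induct:
  assumes g: "vosa_aut V g" "has_order g n" and h: "vosa_aut V h" "has_order h n'"
    and comm: "g \<circ> h = h \<circ> g"
    and U: "subspace U" and v: "v \<in> wsp V r"
    and eig: "\<And>v j j'. v \<in> wsp V r \<Longrightarrow> j < n \<Longrightarrow> j' < n' \<Longrightarrow>
       g v = scl V (inverse (exp (2 * pi * \<i> * of_nat j / of_nat n))) v \<Longrightarrow>
       h v = scl V (inverse (exp (2 * pi * \<i> * of_nat j' / of_nat n'))) v \<Longrightarrow> v \<in> U"
  shows "v \<in> U"
proof -
  have n: "n > 0" "g ^^ n = id" and n': "n' > 0" "h ^^ n' = id"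
    using g h by (simp_all add: has_order_def)
  have comm': "g (h x) = h (g x)" for x using comm by (metis comp_apply)
  have "eigproj g n j v \<in> U" if j: "j < n" for j
  proof -
    define z where "z = inverse (exp (2 * pi * \<i> * of_nat j / of_nat n))"
    define x where "x = eigproj g n j v"
    let ?E = "{x. x \<in> wsp V r \<and> g x = scl V z x}"
    have E: "subspace ?E"
      unfolding subspace_def using subspace_wsp[of r] aut_scale[OF g(1), of 0 0]
      by (auto simp: subspace_def aut_add[OF g(1)] aut_scale[OF g(1)] scale_right_distrib scale_left_commute)
    have "x \<in> wsp V r" unfolding x_def by (intro eigproj_mem subspace_wsp v aut_wsp[OF g(1)])
    hence x: "x \<in> ?E" using eigproj_eigen[OF g(1) n(2,1)] by (simp add: x_def z_def)
    have "eigproj h n' j' x \<in> U" if "j' < n'" for j'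
    proof (rule eig[OF _ j that])
      have "eigproj h n' j' x \<in> ?E"
        using x by (rule eigproj_mem[OF E]) (auto simp: aut_wsp[OF h(1)] comm' aut_scale[OF h(1)])
      thus "eigproj h n' j' x \<in> wsp V r"
        "g (eigproj h n' j' x) = scl V (inverse (exp (2 * pi * \<i> * of_nat j / of_nat n))) (eigproj h n' j' x)"
        by (simp_all add: z_def)
    qed (rule eigproj_eigen[OF h(1) n'(2,1)])
    hence "(\<Sum>j'<n'. eigproj h n' j' x) \<in> U" by (intro subspace_sum U) auto
    thus ?thesis unfolding eigproj_sum[OF n'(1)] x_def .
  qed
  hence "(\<Sum>j<n. eigproj g n j v) \<in> U" by (intro subspace_sum U) auto
  thus ?thesis unfolding eigproj_sum[OF n(1)] .
qed

lemma par_aut_eq_self: "par_hom V False v \<Longrightarrow> par_aut V v = v"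
  unfolding par_aut_def par_hom_def by (subst (3) wcomp_sum) (auto intro!: sum.cong)

text \<open>An eigenvalue of an operator of finite order is a root of unity. This recovers the
  condition on lambda under which the expansions of Q_k converge; the formal relations quantify over
  every complex \<open>lam\<close>.\<close>

lemma norm_eigenvalue:
  assumes h: "vosa_aut V h" "has_order h n" and v: "h v = scl V (inverse c) v" "v \<noteq> 0"
  shows "cmod c = 1"
proof -
  have "(h ^^ k) v = scl V (inverse c ^ k) v" for k
    by (induction k) (simp_all add: aut_scale[OF h(1)] v mult.commute)
  from this[of n] have "scl V 1 v = scl V (inverse c ^ n) v"
    using h(2) by (simp add: has_order_def)
  hence "inverse c ^ n = 1" using v(2) unfolding scale_cancel_right by simp
  moreover have "n \<noteq> 0" using h(2) by (simp add: has_order_def)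
  ultimately have "cmod (inverse c) = 1" using power_eq_1_iff by blast
  thus ?thesis by (simp add: norm_inverse)
qed

subsection \<open>Eigenvectors of L[0]\<close>

definition invariants :: "('v \<Rightarrow> 'v) \<Rightarrow> ('v \<Rightarrow> 'v) \<Rightarrow> 'v set" where
  "invariants g h = {v. par_hom V False v \<and> g v = v \<and> h v = v}"

lemma subspace_invariants:
  assumes "vosa_aut V g" "vosa_aut V h"
  shows "subspace (invariants g h)"
proof -
  have "par_hom V False 0" using wcomp_wsp_eq[OF subspace_0[OF subspace_wsp[of 0]]] by (simp add: par_hom_def)
  moreover have "par_hom V False (u + v)" if "par_hom V False u" "par_hom V False v" for u v
    using that unfolding par_hom_def wcomp_add by (metis add_0)
  moreover have "par_hom V False (scl V a u)" if "par_hom V False u" for a u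
    using that unfolding par_hom_def wcomp_scale by (metis scale_zero_right)
  ultimately show ?thesis
    using aut_scale[OF assms(1), of 0 0] aut_scale[OF assms(2), of 0 0]
    by (auto simp: subspace_def invariants_def aut_add[OF assms(1)] aut_add[OF assms(2)]
        aut_scale[OF assms(1)] aut_scale[OF assms(2)])
qed

text \<open>On \<open>wsp V r\<close> the operator \<open>L[0]\<close> is \<open>r\<close> plus a weight-lowering operator, hence it is triangular
  with distinct eigenvalues on distinct weights, and so diagonalisable.\<close>

lemma invariant_in_span_L0_eigenvectors:
  assumes g: "vosa_aut V g" and h: "vosa_aut V h"
    and "v \<in> wsp V r" "r \<in> \<int>" "g v = v" "h v = v"
  shows "v \<in> span {e \<in> invariants g h. \<exists>s\<le>r. Lbr V 0 e = scl V (of_real s) e}"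
proof -
  define E where "E r = {e \<in> invariants g h. \<exists>s\<le>r. Lbr V 0 e = scl V (of_real s) e}" for r :: real
  have E_mono: "span (E r) \<subseteq> span (E r')" if "r \<le> r'" for r r'
    unfolding E_def using that by (intro span_mono) (auto intro: order_trans)
  have E_inv: "span (E r) \<subseteq> invariants g h" for r
    by (intro span_minimal subspace_invariants g h) (auto simp: E_def)
  have "r \<in> \<int> \<longrightarrow> g v = v \<longrightarrow> h v = v \<longrightarrow> v \<in> span (E r)"
    using assms(3)
  proof (induction rule: weight_induct)
    case (step r v)
    show ?case
    proof (intro impI)
      assume r: "r \<in> \<int>" and gv: "g v = v" and hv: "h v = v"
      define A where "A x = scl V (of_real r) x - Lbr V 0 x" for x
      have A_add: "A (x + y) = A x + A y" and A_scale: "A (scl V c x) = scl V c (A x)" for x y c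
        by (simp_all add: A_def Lbr_add Lbr_scale scale_right_distrib scale_right_diff_distrib scale_left_commute mult.commute)
      have A_0: "A 0 = 0" using A_scale[of 0 0] by simp
      \<comment> \<open>Since L(0)v = rv, this difference is \<open>A v\<close>. The modes
        \<omega>(m)v with m > 1 are again invariant, of integral weight at most r - 1, so the
        induction hypothesis applies to them.\<close>
      have "Y V (om V) 1 v - brk V (om V) 1 v \<in> span (E (r - 1))"
      proof (rule Y_minus_brk[OF om_wsp subspace_span])
        fix m :: int assume m: "m > 1"
        have wt: "Y V (om V) m v \<in> wsp V (2 + r - of_int m - 1)" by (rule Y_wsp[OF om_wsp step.hyps])
        have le: "2 + r - of_int m - 1 \<le> r - 1" using m by linarith
        have "Y V (om V) m v \<in> span (E (2 + r - of_int m - 1))"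
          using step.IH[OF le wt] r
          by (simp add: aut_Y[OF g] aut_Y[OF h] aut_om[OF g] aut_om[OF h] gv hv)
        thus "Y V (om V) m v \<in> span (E (r - 1))" using E_mono[OF le] by blast
      qed
      hence "A v \<in> span (E (r - 1))" by (simp add: A_def Lbr_eq L0_wsp[OF step.hyps])
      \<comment> \<open>On an eigenvector of eigenvalue s \<le> r - 1 the operator \<open>A\<close>
        is multiplication by r - s, which is nonzero, so \<open>A\<close> reaches all of this span.
        A preimage u of \<open>A v\<close> then corrects v to an eigenvector v - u of eigenvalue
        r.\<close>
      moreover have "span (E (r - 1)) \<subseteq> A ` span (E (r - 1))"
      proof (rule span_minimal)
        show "E (r - 1) \<subseteq> A ` span (E (r - 1))"
        proof
          fix e assume e: "e \<in> E (r - 1)"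
          then obtain s where s: "s \<le> r - 1" "Lbr V 0 e = scl V (of_real s) e" by (auto simp: E_def)
          have "A e = scl V (of_real (r - s)) e"
            by (simp add: A_def s(2) scale_left_diff_distrib)
          hence "A (scl V (inverse (of_real (r - s))) e) = scl V (inverse (of_real (r - s)) * of_real (r - s)) e"
            by (simp add: A_scale)
          also have "\<dots> = e" using s(1) by simp
          finally show "e \<in> A ` span (E (r - 1))"
            using span_scale[OF span_base[OF e]] by (intro image_eqI[OF sym])
        qed
        show "subspace (A ` span (E (r - 1)))"
          unfolding subspace_def
          by (auto simp flip: A_add A_scale intro: image_eqI[of 0 A 0] span_zero A_0[symmetric] span_add span_scale)
      qed
      ultimately obtain u where u: "u \<in> span (E (r - 1))" "A u = A v" by (metis image_iff subsetD)
      have "A (v - u) = 0"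
        using A_add[of "v - u" u] u(2) by simp
      hence "Lbr V 0 (v - u) = scl V (of_real r) (v - u)" by (simp add: A_def)
      moreover have "v - u \<in> invariants g h"
        using u(1) E_inv[of "r - 1"] par_hom_wsp[OF step.hyps, of False] r gv hv
        by (intro subspace_diff subspace_invariants g h) (auto simp: invariants_def)
      ultimately have "v - u \<in> span (E r)" by (intro span_base) (auto simp: E_def)
      moreover have "u \<in> span (E r)" using u(1) E_mono[of "r - 1" r] by auto
      ultimately show "v \<in> span (E r)" using span_add[of "v - u" "E r" u] by simp
    qed
  qed (simp add: span_zero)
  thus ?thesis using assms by (simp add: E_def)
qed

end

section \<open>Convergence of formal one-point functions\<close>

lemma gmul_zero_right [simp]: "gmul E (\<lambda>e. 0) e = 0"
  by (simp add: gmul_def)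

lemma gmul_Q_0:
  "gmul (Q_q 0 r lam) f e = - f e"
proof -
  have "{(a, b). a + b = e \<and> Q_q 0 r lam a \<noteq> 0 \<and> f b \<noteq> 0} = (if f e = 0 then {} else {(0, e)})"
    by (auto simp: Q_q_def split: if_splits)
  thus ?thesis by (simp add: gmul_def Q_q_def)
qed

text \<open>The common shape of the identities to be transferred: one summand \<open>f0\<close>
  without a coefficient series, plus finitely many products.\<close>

lemma geval_lincomb:
  assumes "finite I" "T > 0" "gconv f0 \<tau>"
    and "\<And>i. i \<in> I \<Longrightarrow> gconv (E i) \<tau>" "\<And>i. i \<in> I \<Longrightarrow> nonneg_supp T (E i)"
    and "\<And>i. i \<in> I \<Longrightarrow> gconv (f i) \<tau>" "\<And>i. i \<in> I \<Longrightarrow> fser_ok T (f i)"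
  shows "geval (\<lambda>e. f0 e + (\<Sum>i\<in>I. c i * gmul (E i) (f i) e)) \<tau>
       = geval f0 \<tau> + (\<Sum>i\<in>I. c i * geval (E i) \<tau> * geval (f i) \<tau>)"
proof -
  have *: "gconv (gmul (E i) (f i)) \<tau> \<and> geval (gmul (E i) (f i)) \<tau> = geval (E i) \<tau> * geval (f i) \<tau>"
    if "i \<in> I" for i
    using that assms by (intro geval_gmul finite_gmul_index[of T]) auto
  hence **: "gconv (\<lambda>e. c i * gmul (E i) (f i) e) \<tau> \<and>
      geval (\<lambda>e. c i * gmul (E i) (f i) e) \<tau> = c i * geval (E i) \<tau> * geval (f i) \<tau>" if "i \<in> I" for i
    using geval_cmult[of "gmul (E i) (f i)" \<tau> "c i"] that by auto
  have "gconv (\<lambda>e. \<Sum>i\<in>I. c i * gmul (E i) (f i) e) \<tau> \<and>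
      geval (\<lambda>e. \<Sum>i\<in>I. c i * gmul (E i) (f i) e) \<tau> = (\<Sum>i\<in>I. geval (\<lambda>e. c i * gmul (E i) (f i) e) \<tau>)"
    using ** assms(1) by (intro geval_sum) auto
  thus ?thesis using geval_add[OF assms(3)] ** by simp
qed

lemma geval_zero: "geval (\<lambda>e. 0) \<tau> = 0"
  by (simp add: geval_def)

locale formal_one_point = vertex_superalgebra V for V :: "('v::ab_group_add) vosa" +
  fixes g h :: "'v \<Rightarrow> 'v" and T T1 :: nat and S :: "'v \<Rightarrow> gser"
  assumes C2: "C2_cofinite V" and g: "vosa_aut V g" and h: "vosa_aut V h"
    and comm: "g \<circ> h = h \<circ> g" and g_order: "has_order g T" and h_order: "has_order h T1"
    and formal: "formal_1pt V g h T T1 S"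
begin

section \<open>The defining relations with finite sums\<close>

lemma T_pos: "T > 0"
  using g_order by (simp add: has_order_def)

lemma S_ok: "fser_ok T (S v)"
  and S_add: "S (u + v) e = S u e + S v e"
  and S_scale: "S (scl V a v) e = a * S v e"
  using formal unfolding formal_1pt_def by simp_all

lemma S_zero: "S 0 = (\<lambda>e. 0)"
  using S_scale[of 0 0] by auto

lemma S_brk_0:
  assumes "par_hom V p v" "g v = v" "h v = v"
  shows "S (brk V v 0 w) e = 0"
  using formal assms unfolding formal_1pt_def by (elim conjE) blast

text \<open>Which terms of \<open>fsum\<close> are nonzero may depend on the exponent e. A cutoff
  \<open>K\<close> from truncation serves all e at once, so the relation becomes an identity between
  series.\<close>

lemma S_brk_minus2:
  assumes "par_hom V p v" "g v = v" "h v = v" and K: "\<forall>k\<ge>K. brk V v (2 * int k - 2) w = 0"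
  shows "S (brk V v (-2) w) e
     + (\<Sum>k\<in>{2..<K}. of_nat (2*k - 1) * gmul (eis_q k) (S (brk V v (2 * int k - 2) w)) e) = 0"
proof -
  have "fsum (\<lambda>k::nat. if 2 \<le> k then of_nat (2*k - 1) * gmul (eis_q k) (S (brk V v (2 * int k - 2) w)) e else 0)
     = (\<Sum>k\<in>{2..<K}. if 2 \<le> k then of_nat (2*k - 1) * gmul (eis_q k) (S (brk V v (2 * int k - 2) w)) e else 0)"
    by (rule fsum_eq_sum) (auto simp: K S_zero)
  also have "\<dots> = (\<Sum>k\<in>{2..<K}. of_nat (2*k - 1) * gmul (eis_q k) (S (brk V v (2 * int k - 2) w)) e)"
    by (intro sum.cong) auto
  finally have fs: "fsum (\<lambda>k::nat. if 2 \<le> k then of_nat (2*k - 1) * gmul (eis_q k) (S (brk V v (2 * int k - 2) w)) e else 0) = \<dots>" .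
  have "S (brk V v (-2) w) e
     + fsum (\<lambda>k::nat. if 2 \<le> k then of_nat (2*k - 1) * gmul (eis_q k) (S (brk V v (2 * int k - 2) w)) e else 0) = 0"
    using formal assms(1-3) unfolding formal_1pt_def by (elim conjE) blast
  thus ?thesis unfolding fs .
qed

lemma S_eigenvector:
  assumes "j < T" "par_hom V p v"
    and "g v = scl V (inverse (exp (2 * pi * \<i> * of_nat j / of_nat T))) v" "h v = scl V (inverse lam) v"
    and "p \<or> j \<noteq> 0 \<or> lam \<noteq> 1"
  shows "S v e = 0"
  using formal assms unfolding formal_1pt_def by (elim conjE) blast

lemma S_brk_Q:
  assumes "j < T" "par_hom V p v"
    and "g v = scl V (inverse (exp (2 * pi * \<i> * of_nat j / of_nat T))) v" "h v = scl V (inverse lam) v"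
    and "j \<noteq> 0 \<or> lam \<noteq> 1" and K: "\<forall>k\<ge>K. brk V v (int k - 1) w = 0"
  shows "(\<Sum>k<K. gmul (Q_q k (real j / real T) lam) (S (brk V v (int k - 1) w)) e) = 0"
proof -
  have "fsum (\<lambda>k::nat. gmul (Q_q k (real j / real T) lam) (S (brk V v (int k - 1) w)) e)
     = (\<Sum>k<K. gmul (Q_q k (real j / real T) lam) (S (brk V v (int k - 1) w)) e)"
    by (rule fsum_eq_sum) (auto simp: K S_zero)
  moreover have "fsum (\<lambda>k::nat. gmul (Q_q k (real j / real T) lam) (S (brk V v (int k - 1) w)) e) = 0"
    using formal assms(1-5) unfolding formal_1pt_def by (elim conjE) blast
  ultimately show ?thesis by simp
qed

lemma S_Lbr_minus2:
  assumes "par_aut V v = v" "g v = v" "h v = v" "Lbr V 0 v = scl V k v" and K: "\<forall>l\<ge>K. Lbr V (2 * int l - 2) v = 0"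
  shows "S (Lbr V (-2) v) e = gder (S v) e + k * gmul (eis_q 1) (S v) e
          + (\<Sum>l\<in>{2..<K}. gmul (eis_q l) (S (Lbr V (2 * int l - 2) v)) e)"
proof -
  have "fsum (\<lambda>l::nat. if 2 \<le> l then gmul (eis_q l) (S (Lbr V (2 * int l - 2) v)) e else 0)
     = (\<Sum>l\<in>{2..<K}. if 2 \<le> l then gmul (eis_q l) (S (Lbr V (2 * int l - 2) v)) e else 0)"
    by (rule fsum_eq_sum) (auto simp: K S_zero)
  also have "\<dots> = (\<Sum>l\<in>{2..<K}. gmul (eis_q l) (S (Lbr V (2 * int l - 2) v)) e)"
    by (intro sum.cong) auto
  finally have fs: "fsum (\<lambda>l::nat. if 2 \<le> l then gmul (eis_q l) (S (Lbr V (2 * int l - 2) v)) e else 0) = \<dots>" .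
  have "S (Lbr V (-2) v) e = gder (S v) e + k * gmul (eis_q 1) (S v) e
     + fsum (\<lambda>l::nat. if 2 \<le> l then gmul (eis_q l) (S (Lbr V (2 * int l - 2) v)) e else 0)"
    using formal assms(1-4) unfolding formal_1pt_def by (elim conjE) blast
  thus ?thesis unfolding fs .
qed

lemma ex_brk_bound:
  "\<exists>K. \<forall>k\<ge>K. brk V v (2 * int k - 2) w = 0 \<and> brk V v (int k - 1) w = 0"
proof -
  obtain N where "\<forall>n\<ge>N. brk V v n w = 0" using brk_truncation by blast
  thus ?thesis by (intro exI[of _ "nat N + 2"]) auto
qed

lemma ex_Lbr_bound: "\<exists>K. \<forall>k\<ge>K. Lbr V (2 * int k - 2) v = 0"
proof -
  obtain N where "\<forall>n\<ge>N. Lbr V n v = 0" using Lbr_truncation by blast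
  thus ?thesis by (intro exI[of _ "nat N + 2"]) auto
qed

section \<open>Domination of all one-point series by finitely many\<close>

definition dom_vectors :: "complex \<Rightarrow> (real \<Rightarrow> real) \<Rightarrow> 'v set" where
  "dom_vectors \<tau> M = {v. dominated \<tau> M (S v)}"

lemma subspace_dom_vectors: "subspace (dom_vectors \<tau> M)"
  unfolding subspace_def dom_vectors_def
  by (auto simp: S_zero dominated_0 S_add[abs_def] S_scale[abs_def] dominated_add dominated_cmult)

lemma dominated_gmul_eis: "\<tau> \<in> uhp \<Longrightarrow> dominated \<tau> M f \<Longrightarrow> dominated \<tau> M (gmul (eis_q k) f)"
  using geval_eis nonneg_supp_eis[OF T_pos] by (intro dominated_gmul) auto

lemma dominated_uminus: "dominated \<tau> M f \<Longrightarrow> dominated \<tau> M (\<lambda>e. - f e)"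
  using dominated_cmult[of \<tau> M f "-1"] by simp

text \<open>The vector u(-2)w has weight a + b + 1. Modulo weights at most a + b it is a bracket
  product, which \<open>O(g,h)\<close> rewrites as a combination, with convergent coefficient
  series, of bracket products of weight at most a + b.\<close>

lemma Y_minus2_dominated:
  assumes t: "\<tau> \<in> uhp" and u: "u \<in> wsp V a" and w: "w \<in> wsp V b" and j: "j < T" "j' < T1"
    and gu: "g u = scl V (inverse (exp (2 * pi * \<i> * of_nat j / of_nat T))) u"
    and hu: "h u = scl V (inverse (exp (2 * pi * \<i> * of_nat j' / of_nat T1))) u"
    and lower: "\<And>s v. s \<le> a + b \<Longrightarrow> v \<in> wsp V s \<Longrightarrow> v \<in> dom_vectors \<tau> M"
  shows "Y V u (-2) w \<in> dom_vectors \<tau> M"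
proof (cases "j = 0 \<and> j' = 0")
  case True
  hence inv: "g u = u" "h u = u" using gu hu by simp_all
  obtain p where p: "par_hom V p u" using ex_par_hom_wsp[OF u] by blast
  obtain K where K: "\<forall>k\<ge>K. brk V u (2 * int k - 2) w = 0" using ex_brk_bound by metis
  have "S (brk V u (-2) w) = (\<lambda>e. \<Sum>k\<in>{2..<K}. - of_nat (2*k - 1) * gmul (eis_q k) (S (brk V u (2 * int k - 2) w)) e)"
    using S_brk_minus2[OF p inv K] by (simp only: fun_eq_iff mult_minus_left sum_negf eq_neg_iff_add_eq_0) simp
  moreover have "dominated \<tau> M (S (brk V u (2 * int k - 2) w))" if "k \<in> {2..<K}" for k
  proof -
    have "brk V u (2 * int k - 2) w \<in> dom_vectors \<tau> M"
      using that by (intro brk_lower_weight[OF u w subspace_dom_vectors] lower) auto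
    thus ?thesis by (simp add: dom_vectors_def)
  qed
  ultimately have "brk V u (-2) w \<in> dom_vectors \<tau> M"
    by (simp only: dom_vectors_def mem_Collect_eq)
       (intro dominated_sum dominated_cmult dominated_gmul_eis t, blast)
  moreover have "Y V u (-2) w - brk V u (-2) w \<in> dom_vectors \<tau> M"
    by (intro Y_minus_brk_lower_weight[OF u w subspace_dom_vectors] lower) auto
  ultimately show ?thesis
    using subspace_add[OF subspace_dom_vectors] by fastforce
next
  case False
  define lam where "lam = exp (2 * pi * \<i> * of_nat j' / of_nat T1)"
  \<comment> \<open>This is L(-1)u. It has weight a + 1 and the eigenvalues of u, and its mode -1 is
    u(-2). The relation for Q, solved by Q_0 = -1 for u'[-1]w, leaves only the modes u'[k] with k
    \<ge> 0.\<close>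
  define u' where "u' = Y V (om V) 0 u"
  have u': "u' \<in> wsp V (a + 1)" using Y_wsp[OF om_wsp u, of 0] by (simp add: u'_def add.commute)
  have gu': "g u' = scl V (inverse (exp (2 * pi * \<i> * of_nat j / of_nat T))) u'"
    and hu': "h u' = scl V (inverse lam) u'"
    by (simp_all add: u'_def lam_def aut_Y[OF g] aut_Y[OF h] aut_om[OF g] aut_om[OF h] gu hu Y_scale_right del: of_real_mult)
  have lam: "cmod lam = 1" by (simp add: lam_def)
  have nontriv: "j \<noteq> 0 \<or> lam \<noteq> 1"
    using False j complex_root_unity_eq_1[of T1 j'] by (auto simp: lam_def dest: dvd_imp_le)
  obtain p where p: "par_hom V p u'" using ex_par_hom_wsp[OF u'] by blast
  obtain K where K: "\<forall>k\<ge>K. brk V u' (int k - 1) w = 0" using ex_brk_bound by metis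
  hence K': "\<forall>k\<ge>Suc K. brk V u' (int k - 1) w = 0" using Suc_leD by blast
  let ?G = "\<lambda>k e. gmul (Q_q k (real j / real T) lam) (S (brk V u' (int k - 1) w)) e"
  have "S (brk V u' (-1) w) = (\<lambda>e. \<Sum>k<K. ?G (Suc k) e)"
  proof
    fix e
    have "(\<Sum>k<Suc K. ?G k e) = 0" by (rule S_brk_Q[OF j(1) p gu' hu' nontriv K'])
    hence "- S (brk V u' (-1) w) e + (\<Sum>k<K. ?G (Suc k) e) = 0"
      unfolding sum.lessThan_Suc_shift by (simp add: gmul_Q_0)
    thus "S (brk V u' (-1) w) e = (\<Sum>k<K. ?G (Suc k) e)" by simp
  qed
  moreover have "dominated \<tau> M (?G (Suc k))" for k
  proof -
    have "brk V u' (int (Suc k) - 1) w \<in> dom_vectors \<tau> M"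
      by (intro brk_lower_weight[OF u' w subspace_dom_vectors] lower) auto
    moreover have "gconv (Q_q (Suc k) (real j / real T) lam) \<tau>"
      using geval_Q[of "real j / real T" lam \<tau>] lam nontriv t j T_pos by auto
    ultimately show ?thesis
      using nonneg_supp_Q[OF j(1)] by (intro dominated_gmul) (auto simp: dom_vectors_def)
  qed
  ultimately have "brk V u' (-1) w \<in> dom_vectors \<tau> M"
    unfolding dom_vectors_def by (simp only: mem_Collect_eq) (intro dominated_sum)
  moreover have "Y V u' (-1) w - brk V u' (-1) w \<in> dom_vectors \<tau> M"
    by (intro Y_minus_brk_lower_weight[OF u' w subspace_dom_vectors] lower) auto
  ultimately have "Y V u' (-1) w \<in> dom_vectors \<tau> M"
    using subspace_add[OF subspace_dom_vectors] by fastforce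
  thus ?thesis by (simp add: u'_def translation)
qed

text \<open>N bounds the weights occurring in a finite set that complements the products u(-2)w. It
  depends on neither \<tau> nor \<open>M\<close>, so \<open>M\<close> may later be built from
  generators of weight at most N.\<close>

lemma ex_dominating_weight:
  "\<exists>N. \<forall>\<tau> M. \<tau> \<in> uhp \<longrightarrow> (\<forall>r v. r \<le> N \<longrightarrow> v \<in> wsp V r \<longrightarrow> v \<in> dom_vectors \<tau> M) \<longrightarrow> dom_vectors \<tau> M = UNIV"
proof -
  obtain B where B: "finite B" "span (B \<union> {Y V u (-2) v | u v. True}) = UNIV"
    using C2 unfolding C2_cofinite_def by blast
  have "finite (\<Union>b\<in>B. {r. wcomp V b r \<noteq> 0})" using B(1) by (intro finite_UN_I finite_wcomp)
  then obtain N where N: "\<And>b r. b \<in> B \<Longrightarrow> wcomp V b r \<noteq> 0 \<Longrightarrow> r \<le> N"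
    using bdd_above_finite unfolding bdd_above_def by (metis (mono_tags, lifting) UN_I mem_Collect_eq)
  have "dom_vectors \<tau> M = UNIV"
    if t: "\<tau> \<in> uhp" and base: "\<And>r v. r \<le> N \<Longrightarrow> v \<in> wsp V r \<Longrightarrow> v \<in> dom_vectors \<tau> M" for \<tau> M
  proof -
    let ?D = "dom_vectors \<tau> M"
    note D = subspace_dom_vectors[of \<tau> M]
    have "v \<in> ?D" if "v \<in> wsp V r" for v r
      using that
    proof (induction rule: weight_induct)
      case (zero r)
      show ?case by (rule subspace_0[OF D])
    next
      case (step r v)
      show ?case
      proof (cases "r \<le> N")
        case True
        thus ?thesis using base step.hyps by blast
      next
        case False
        \<comment> \<open>The spanning set given by C2-cofiniteness is not homogeneous. Testing only
          the component of weight r reduces the claim to a subspace containing every spanning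
          vector.\<close>
        let ?U = "{x. wcomp V x r \<in> ?D}"
        have U: "subspace ?U"
          unfolding subspace_def using subspace_0[OF D] wcomp_wsp_eq[OF subspace_0[OF subspace_wsp[of 0]]]
          by (auto simp: wcomp_add wcomp_scale subspace_add[OF D] subspace_scale[OF D])
        have "Y V u (-2) w \<in> ?U" for u w
        proof -
          have "u \<in> {u. Y V u (-2) w \<in> ?U}"
          proof (rule weight_space_induct[OF subspace_vimage_Y_left[OF U]])
            fix a u assume "u \<in> wsp V a"
            thus "u \<in> {u. Y V u (-2) w \<in> ?U}"
            proof (rule joint_eigenvector_induct[OF g g_order h h_order comm subspace_vimage_Y_left[OF U]])
              fix u j j'
              assume u: "u \<in> wsp V a" "j < T" "j' < T1"
                "g u = scl V (inverse (exp (2 * pi * \<i> * of_nat j / of_nat T))) u"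
                "h u = scl V (inverse (exp (2 * pi * \<i> * of_nat j' / of_nat T1))) u"
              have "w \<in> {w. Y V u (-2) w \<in> ?U}"
              proof (rule weight_space_induct[OF subspace_vimage_Y_right[OF U]])
                fix b w assume w: "w \<in> wsp V b"
                have wt: "Y V u (-2) w \<in> wsp V (a + b + 1)" using Y_wsp[OF u(1) w, of "-2"] by (simp add: algebra_simps)
                show "w \<in> {w. Y V u (-2) w \<in> ?U}"
                proof (cases "r = a + b + 1")
                  case True
                  \<comment> \<open>Here r = a + b + 1, so the weights at most a + b demanded by the
                    reduction are those at most r - 1 covered by the induction hypothesis.\<close>
                  have "Y V u (-2) w \<in> ?D"
                    using True by (intro Y_minus2_dominated[OF t u(1) w u(2-5)] step.IH) auto
                  thus ?thesis using wcomp_wsp_eq[OF wt] True by simp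
                next
                  case False
                  thus ?thesis using wcomp_wsp_eq[OF wt] subspace_0[OF D] by simp
                qed
              qed
              thus "u \<in> {u. Y V u (-2) w \<in> ?U}" by simp
            qed
          qed
          thus ?thesis by simp
        qed
        \<comment> \<open>As r > N, no element of \<open>B\<close> has a component of weight
          r.\<close>
        moreover have "B \<subseteq> ?U" using N False subspace_0[OF D] by force
        ultimately have "span (B \<union> {Y V u (-2) v | u v. True}) \<subseteq> ?U"
          using U by (intro span_minimal) auto
        hence "v \<in> ?U" using B(2) by blast
        thus ?thesis using wcomp_wsp_eq[OF step.hyps] by simp
      qed
    qed
    hence "v \<in> ?D" for v using weight_space_induct[OF D] by blast
    thus ?thesis by blast
  qed
  thus ?thesis by blast
qed

text \<open>On joint eigenvectors there are two cases: either the parity or an eigenvalue is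
  nontrivial and S vanishes, or the vector is invariant and hence a combination of
  L[0]-eigenvectors, where the L[-2] identity applies.\<close>

lemma gder_dominated:
  assumes t: "\<tau> \<in> uhp" and all: "dom_vectors \<tau> M = UNIV"
  shows "dominated \<tau> M (gder (S v))"
proof -
  let ?U = "{v. dominated \<tau> M (gder (S v))}"
  have dom: "dominated \<tau> M (S x)" for x using all by (auto simp: dom_vectors_def)
  have gder_add: "gder (S (x + y)) = (\<lambda>e. gder (S x) e + gder (S y) e)"
    and gder_scale: "gder (S (scl V c x)) = (\<lambda>e. c * gder (S x) e)" for x y c
    by (auto simp: gder_def S_add S_scale algebra_simps)
  have U: "subspace ?U"
    unfolding subspace_def
    by (auto simp: gder_add gder_scale dominated_add dominated_cmult S_zero gder_def[of "\<lambda>e. 0", abs_def] dominated_0)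
  have eig: "e \<in> ?U" if e: "e \<in> invariants g h" "Lbr V 0 e = scl V k e" for e k
  proof -
    obtain K where K: "\<forall>l\<ge>K. Lbr V (2 * int l - 2) e = 0" using ex_Lbr_bound by metis
    \<comment> \<open>The L[-2] identity solved for q d/dq; every other term is a dominated series
      or its product with an Eisenstein series.\<close>
    have "gder (S e) = (\<lambda>x. S (Lbr V (-2) e) x + - (k * gmul (eis_q 1) (S e) x
          + (\<Sum>l\<in>{2..<K}. gmul (eis_q l) (S (Lbr V (2 * int l - 2) e)) x)))"
      using S_Lbr_minus2[of e k K] e K par_aut_eq_self by (auto simp: fun_eq_iff invariants_def)
    moreover have "dominated \<tau> M \<dots>"
      by (intro dominated_add dominated_uminus dominated_cmult dominated_sum dominated_gmul_eis t dom)
    ultimately show ?thesis by simp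
  qed
  have "v \<in> ?U"
  proof (rule weight_space_induct[OF U])
    fix r v assume "v \<in> wsp V r"
    thus "v \<in> ?U"
    proof (rule joint_eigenvector_induct[OF g g_order h h_order comm U])
      fix v j j'
      assume v: "v \<in> wsp V r" and j: "j < T" "j' < T1"
        and gv: "g v = scl V (inverse (exp (2 * pi * \<i> * of_nat j / of_nat T))) v"
        and hv: "h v = scl V (inverse (exp (2 * pi * \<i> * of_nat j' / of_nat T1))) v"
      define lam where "lam = exp (2 * pi * \<i> * of_nat j' / of_nat T1)"
      \<comment> \<open>The zero vector is homogeneous of both parities; it is declared odd here,
        and even parity is reserved for integral weights.\<close>
      obtain p where p: "par_hom V p v" "\<not> p \<Longrightarrow> r \<in> \<int> \<or> v = 0"
      proof (cases "v = 0 \<or> r - 1/2 \<in> \<int>")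
        case True
        hence "par_hom V True v" using par_hom_wsp[OF v, of True] wcomp_wsp_eq[OF v] by (auto simp: par_hom_def)
        thus thesis by (rule that) simp
      next
        case False
        hence r: "r \<in> \<int>" using half_weight_cases[OF v] by blast
        hence "par_hom V False v" using par_hom_wsp[OF v, of False] by simp
        thus thesis by (rule that) (simp add: r)
      qed
      show "v \<in> ?U"
      proof (cases "p \<or> j \<noteq> 0 \<or> lam \<noteq> 1")
        case True
        have "S v = (\<lambda>e. 0)"
          using S_eigenvector[OF j(1) p(1) gv hv[folded lam_def] True] by auto
        thus ?thesis by (simp add: gder_def[of "\<lambda>e. 0", abs_def] dominated_0)
      next
        case False
        hence inv: "g v = v" "h v = v" and r: "r \<in> \<int> \<or> v = 0"
          using p(2) gv hv[folded lam_def] by auto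
        show ?thesis
        proof (cases "v = 0")
          case True
          thus ?thesis using subspace_0[OF U] by simp
        next
          case False
          with r have "r \<in> \<int>" by simp
          from invariant_in_span_L0_eigenvectors[OF g h v this inv]
          have "v \<in> span {e \<in> invariants g h. \<exists>s\<le>r. Lbr V 0 e = scl V (of_real s) e}" .
          moreover have "span {e \<in> invariants g h. \<exists>s\<le>r. Lbr V 0 e = scl V (of_real s) e} \<subseteq> ?U"
            using eig by (intro span_minimal U) blast
          ultimately show ?thesis by blast
        qed
      qed
    qed
  qed
  thus ?thesis by simp
qed

lemma gconv_S:
  assumes t: "\<tau> \<in> uhp"
  shows "gconv (S v) \<tau>"
proof -
  obtain N where N: "\<And>\<tau> M. \<tau> \<in> uhp \<Longrightarrow> (\<And>r v. r \<le> N \<Longrightarrow> v \<in> wsp V r \<Longrightarrow> v \<in> dom_vectors \<tau> M) \<Longrightarrow> dom_vectors \<tau> M = UNIV"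
    using ex_dominating_weight by metis
  obtain W where W: "finite W" "\<And>r. r \<le> N \<Longrightarrow> wsp V r \<subseteq> span W"
    using ex_finite_generators by metis
  \<comment> \<open>With this choice the generators dominate themselves with constant 1, so their
    span, hence all of V, is dominated, and so are the Euler derivatives of the generating
    series.\<close>
  define M where "M = (\<lambda>x. \<Sum>f\<in>S ` W. trunc_norm \<tau> x f)"
  note fin = fser_ok_finite[OF S_ok T_pos]
  have "W \<subseteq> dom_vectors \<tau> M"
    unfolding dom_vectors_def M_def using W(1) fin by (auto intro!: dominated_trunc_norm_sum)
  hence "span W \<subseteq> dom_vectors \<tau> M" by (intro span_minimal subspace_dom_vectors)
  hence all: "dom_vectors \<tau> M = UNIV" using W(2) by (intro N t) blast
  show ?thesis
  proof (rule gconv_if_gder_dominated[of "S ` W"])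
    show "finite (S ` W)" using W(1) by simp
    show "finite {e. f e \<noteq> 0 \<and> Re e \<le> x}" if "f \<in> S ` W" for f x using that fin by auto
    show "dominated \<tau> (\<lambda>x. \<Sum>f\<in>S ` W. trunc_norm \<tau> x f) (gder f)" if "f \<in> S ` W" for f
      using that gder_dominated[OF t all] by (auto simp: M_def)
    show "dominated \<tau> (\<lambda>x. \<Sum>f\<in>S ` W. trunc_norm \<tau> x f) (S v)"
      using all by (auto simp: dom_vectors_def M_def)
  qed
qed

section \<open>Holomorphy and transfer of the formal identities\<close>

lemma geval_S_has_derivative:
  assumes "\<tau> \<in> uhp"
  shows "gconv (gder (S v)) \<tau>"
    and "(geval (S v) has_field_derivative 2 * pi * \<i> * geval (gder (S v)) \<tau>) (at \<tau>)"
proof -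
  obtain c where c: "c \<ge> 0" "\<And>e. S v e \<noteq> 0 \<Longrightarrow> Re e \<ge> - c \<and> \<bar>Im e\<bar> \<le> c"
    using fser_ok_bounds[OF S_ok] by metis
  show "gconv (gder (S v)) \<tau>"
    and "(geval (S v) has_field_derivative 2 * pi * \<i> * geval (gder (S v)) \<tau>) (at \<tau>)"
    using geval_has_derivative[of "S v" c, OF c(2,1) gconv_S assms] by blast+
qed

lemma holomorphic_geval_S: "geval (S v) holomorphic_on uhp"
  unfolding holomorphic_on_def field_differentiable_def
  using geval_S_has_derivative(2) has_field_derivative_at_within by blast

text \<open>Every condition has a formal counterpart among the hypotheses. Truncation cuts the
  formal and the analytic sum at the same index, after which evaluation is linear and multiplicative
  and turns q d/dq into d/d\<tau> divided by 2 pi i.\<close>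

lemma conf_block_geval_S: "conf_block V g h T T1 (\<lambda>v \<tau>. geval (S v) \<tau>)"
  unfolding conf_block_def
proof (intro conjI allI impI)
  fix v
  show "geval (S v) holomorphic_on uhp" by (rule holomorphic_geval_S)
next
  fix u v \<tau> assume t: "\<tau> \<in> uhp"
  show "geval (S (u + v)) \<tau> = geval (S u) \<tau> + geval (S v) \<tau>"
    using geval_add[OF gconv_S[OF t] gconv_S[OF t]] by (simp add: S_add[abs_def])
next
  fix a v \<tau> assume t: "\<tau> \<in> uhp"
  show "geval (S (scl V a v)) \<tau> = a * geval (S v) \<tau>"
    using geval_cmult[OF gconv_S[OF t]] by (simp add: S_scale[abs_def])
next
  fix p v w \<tau> assume t: "\<tau> \<in> uhp" and v: "par_hom V p v" "g v = v" "h v = v"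
  have "S (brk V v 0 w) = (\<lambda>e. 0)" using S_brk_0[OF v] by auto
  thus "geval (S (brk V v 0 w)) \<tau> = 0" by (simp add: geval_zero)
next
  fix p v w \<tau> assume t: "\<tau> \<in> uhp" and v: "par_hom V p v" "g v = v" "h v = v"
  obtain K where K: "\<forall>k\<ge>K. brk V v (2 * int k - 2) w = 0" using ex_brk_bound by metis
  let ?f = "\<lambda>k. S (brk V v (2 * int k - 2) w)"
  have "fsum (\<lambda>k::nat. if 2 \<le> k then of_nat (2*k - 1) * eis k \<tau> * geval (?f k) \<tau> else 0)
     = (\<Sum>k\<in>{2..<K}. if 2 \<le> k then of_nat (2*k - 1) * eis k \<tau> * geval (?f k) \<tau> else 0)"
    by (rule fsum_eq_sum) (auto simp: K S_zero geval_zero)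
  also have "\<dots> = (\<Sum>k\<in>{2..<K}. of_nat (2*k - 1) * geval (eis_q k) \<tau> * geval (?f k) \<tau>)"
    using geval_eis[OF t] by (intro sum.cong) auto
  also have "geval (S (brk V v (-2) w)) \<tau> + \<dots>
     = geval (\<lambda>e. S (brk V v (-2) w) e + (\<Sum>k\<in>{2..<K}. of_nat (2*k - 1) * gmul (eis_q k) (?f k) e)) \<tau>"
    using geval_eis[OF t] nonneg_supp_eis[OF T_pos] T_pos S_ok gconv_S[OF t]
    by (intro geval_lincomb[symmetric, where T = T]) auto
  also have "\<dots> = 0" by (simp only: S_brk_minus2[OF v K] geval_zero)
  finally show "geval (S (brk V v (-2) w)) \<tau>
      + fsum (\<lambda>k::nat. if 2 \<le> k then of_nat (2*k - 1) * eis k \<tau> * geval (?f k) \<tau> else 0) = 0" .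
next
  fix p v w \<tau> j lam
  assume "\<tau> \<in> uhp" "j < T" "par_hom V p v"
    and "g v = scl V (inverse (exp (2 * pi * \<i> * of_nat j / of_nat T))) v" "h v = scl V (inverse lam) v"
    and "p \<or> j \<noteq> 0 \<or> lam \<noteq> 1"
  hence "S v = (\<lambda>e. 0)" using S_eigenvector[of j p v lam] by auto
  thus "geval (S v) \<tau> = 0" by (simp add: geval_zero)
next
  fix p v w \<tau> j lam
  assume t: "\<tau> \<in> uhp" and v: "j < T" "par_hom V p v"
    "g v = scl V (inverse (exp (2 * pi * \<i> * of_nat j / of_nat T))) v" "h v = scl V (inverse lam) v"
    and nontriv: "j \<noteq> 0 \<or> lam \<noteq> 1"
  show "fsum (\<lambda>k::nat. Qfun k (real j / real T) lam \<tau> * geval (S (brk V v (int k - 1) w)) \<tau>) = 0"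
  proof (cases "v = 0")
    case True
    thus ?thesis by (simp add: brk_0_left S_zero geval_zero fsum_def)
  next
    case False
    have lam: "cmod lam = 1" by (rule norm_eigenvalue[OF h h_order v(4) False])
    have Q: "gconv (Q_q k (real j / real T) lam) \<tau> \<and> geval (Q_q k (real j / real T) lam) \<tau> = Qfun k (real j / real T) lam \<tau>" for k
      using v(1) T_pos nontriv by (intro geval_Q lam t) auto
    obtain K where K: "\<forall>k\<ge>K. brk V v (int k - 1) w = 0" using ex_brk_bound by metis
    let ?f = "\<lambda>k. S (brk V v (int k - 1) w)"
    have "fsum (\<lambda>k::nat. Qfun k (real j / real T) lam \<tau> * geval (?f k) \<tau>)
       = (\<Sum>k<K. Qfun k (real j / real T) lam \<tau> * geval (?f k) \<tau>)"
      by (rule fsum_eq_sum) (auto simp: K S_zero geval_zero)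
    \<comment> \<open>The relation for Q has no summand free of a coefficient series, so the zero
      series \<open>S 0\<close> takes the place of \<open>f0\<close>.\<close>
    also have "\<dots> = geval (S 0) \<tau> + (\<Sum>k<K. 1 * geval (Q_q k (real j / real T) lam) \<tau> * geval (?f k) \<tau>)"
      using Q by (simp add: S_zero geval_zero)
    also have "\<dots> = geval (\<lambda>e. S 0 e + (\<Sum>k<K. 1 * gmul (Q_q k (real j / real T) lam) (?f k) e)) \<tau>"
      using Q nonneg_supp_Q[OF v(1)] T_pos S_ok gconv_S[OF t]
      by (intro geval_lincomb[symmetric, where T = T]) auto
    also have "\<dots> = 0" by (simp add: S_brk_Q[OF v nontriv K] S_zero geval_zero)
    finally show ?thesis .
  qed
next
  fix v k \<tau>
  assume t: "\<tau> \<in> uhp" and v: "par_aut V v = v" "g v = v" "h v = v" "Lbr V 0 v = scl V k v"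
  show "geval (S (Lbr V (-2) v)) \<tau> = deriv (geval (S v)) \<tau> / (2 * pi * \<i>) + k * eis 1 \<tau> * geval (S v) \<tau>
          + fsum (\<lambda>l::nat. if 2 \<le> l then eis l \<tau> * geval (S (Lbr V (2 * int l - 2) v)) \<tau> else 0)"
  proof -
    obtain K where K: "\<forall>l\<ge>K. Lbr V (2 * int l - 2) v = 0" using ex_Lbr_bound by metis
    let ?f = "\<lambda>l. S (Lbr V (2 * int l - 2) v)"
    have "gconv (gmul (eis_q 1) (S v)) \<tau> \<and> geval (gmul (eis_q 1) (S v)) \<tau> = eis 1 \<tau> * geval (S v) \<tau>"
      using geval_gmul[OF _ gconv_S[OF t] finite_gmul_index[OF nonneg_supp_eis[OF T_pos] S_ok T_pos]]
        geval_eis[OF t] by auto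
    hence "gconv (\<lambda>e. k * gmul (eis_q 1) (S v) e) \<tau> \<and>
        geval (\<lambda>e. k * gmul (eis_q 1) (S v) e) \<tau> = k * (eis 1 \<tau> * geval (S v) \<tau>)"
      using geval_cmult by metis
    hence E1: "gconv (\<lambda>e. gder (S v) e + k * gmul (eis_q 1) (S v) e) \<tau> \<and>
        geval (\<lambda>e. gder (S v) e + k * gmul (eis_q 1) (S v) e) \<tau>
          = geval (gder (S v)) \<tau> + k * eis 1 \<tau> * geval (S v) \<tau>"
      using geval_add[OF geval_S_has_derivative(1)[OF t]] by auto
    have "S (Lbr V (-2) v) = (\<lambda>e. (gder (S v) e + k * gmul (eis_q 1) (S v) e)
          + (\<Sum>l\<in>{2..<K}. 1 * gmul (eis_q l) (?f l) e))"
      using S_Lbr_minus2[OF v K] by auto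
    hence "geval (S (Lbr V (-2) v)) \<tau> = geval (\<lambda>e. (gder (S v) e + k * gmul (eis_q 1) (S v) e)
          + (\<Sum>l\<in>{2..<K}. 1 * gmul (eis_q l) (?f l) e)) \<tau>"
      by (rule arg_cong)
    also have "\<dots> = geval (\<lambda>e. gder (S v) e + k * gmul (eis_q 1) (S v) e) \<tau>
          + (\<Sum>l\<in>{2..<K}. 1 * geval (eis_q l) \<tau> * geval (?f l) \<tau>)"
      using E1 geval_eis[OF t] nonneg_supp_eis[OF T_pos] T_pos S_ok gconv_S[OF t]
      by (intro geval_lincomb[where T = T]) auto
    also have "geval (\<lambda>e. gder (S v) e + k * gmul (eis_q 1) (S v) e) \<tau>
        = deriv (geval (S v)) \<tau> / (2 * pi * \<i>) + k * eis 1 \<tau> * geval (S v) \<tau>"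
    proof -
      have "deriv (geval (S v)) \<tau> / (2 * pi * \<i>) = geval (gder (S v)) \<tau>"
        unfolding DERIV_imp_deriv[OF geval_S_has_derivative(2)[OF t]] by simp
      thus ?thesis using E1 by (simp only:)
    qed
    also have "(\<Sum>l\<in>{2..<K}. 1 * geval (eis_q l) \<tau> * geval (?f l) \<tau>)
       = (\<Sum>l\<in>{2..<K}. if 2 \<le> l then eis l \<tau> * geval (?f l) \<tau> else 0)"
      using geval_eis[OF t] by (intro sum.cong) auto
    also have "\<dots> = fsum (\<lambda>l::nat. if 2 \<le> l then eis l \<tau> * geval (?f l) \<tau> else 0)"
      by (rule fsum_eq_sum[symmetric]) (auto simp: K S_zero geval_zero)
    finally show ?thesis .
  qed
qed

end

theorem theorem5p5:
  fixes V :: "('v::ab_group_add) vosa"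
    and g h :: "'v \<Rightarrow> 'v" and T T1 :: nat and S :: "'v \<Rightarrow> gser"
  assumes "is_vosa V" and "C2_cofinite V"
    and "vosa_aut V g" and "vosa_aut V h" and "g \<circ> h = h \<circ> g"
    and "has_order g T" and "has_order h T1"
    and "formal_1pt V g h T T1 S"
  shows "(\<forall>v \<tau>. \<tau> \<in> uhp \<longrightarrow> (\<lambda>e. S v e * qpow e \<tau>) summable_on UNIV)
       \<and> (\<forall>v. (\<lambda>\<tau>. geval (S v) \<tau>) holomorphic_on uhp)
       \<and> conf_block V g h T T1 (\<lambda>v \<tau>. geval (S v) \<tau>)"
proof -
  interpret formal_one_point V g h T T1 S
    using assms by unfold_locales
  show ?thesis
    using gconv_S holomorphic_geval_S conf_block_geval_S by (simp add: gconv_def)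
qed

end
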